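(* Let $p \geq 5$ be a prime and consider the Cayley cubic \[ x^2 + y^2 + z^2 = xyz + 4 \] over $\mathbb{F}_p$. Let $G$ be the group of permutations of the set of solutions $(x,y,z)\in\mathbb{F}_p^3$ generated by the Markoff moves $m_1:(x,y,z)\mapsto(yz-x,y,z)$, $m_2:(x,y,z)\mapsto(x,xz-y,z)$, $m_3:(x,y,z)\mapsto(x,y,xy-z)$ and all permutations of the three coordinates. Write $\varepsilon = (-1)^{(p-1)/2}$, and for each prime $q$ dividing $p^2-1$ let $e_q$ be the exponent of $q$ in $p^2-1$. Let $Q^+$ and $Q^-$ be the (disjoint) sets of odd primes dividing $p+\varepsilon$ and $p-\varepsilon$ respectively, so that \[ p+\varepsilon = 2\prod_{q\in Q^+} q^{e_q}, \qquad p-\varepsilon = 2^{e_2-1}\prod_{q\in Q^-} q^{e_q}. \] Let $D$ be the set of positive divisors $t$ of $p^2-1$ such that $p+1 \mid t$ or $p-1\mid t$. Then there is a bijection $\Phi$ from $D$ to the set of $G$-orbits on the solutions of the Cayley cubic over $\mathbb{F}_p$ such that: for $t=\prod_{q\mid p^2-1} q^{f_q}\in D$ with $t\neq p^2-1$ and $t\neq \frac{p^2-1}{2}$, the orbit $\Phi(t)$ has size \[ \frac{1}{2}\prod_{q\mid p^2-1,\ f_q<e_q} (q^2-1)\, q^{2(e_q-f_q-1)}, \] while for $t = p^2-1$ and $t=\frac{p^2-1}{2}$ the orbit $\Phi(t)$ has twice the size given by this expression. In particular the number of $G$-orbits equals \[ e_2\prod_{q\in Q^-}(e_q+1) + 2\prod_{q\in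 Q^+}(e_q+1) - 2. \]
   Context: Here $\mathbb{F}_p$ is the field with $p$ elements. The orbits are those of the group generated by the three Vieta (Markoff) moves and the coordinate permutations acting on the set of all triples $(x,y,z)\in\mathbb{F}_p^3$ satisfying the equation. Empty products equal $1$. *)

theory Defs
  imports
    "HOL-Algebra.Group_Action"
    "HOL-Algebra.Generated_Groups"
    "HOL-Computational_Algebra.Primes"
    "HOL-Library.Cardinality"
    Complex_Main
begin

definition cayley_solutions :: "('a::field \<times> 'a \<times> 'a) set" where
  "cayley_solutions = {(x, y, z). x\<^sup>2 + y\<^sup>2 + z\<^sup>2 = x * y * z + 4}"

definition markoff_moves :: "('a::field \<times> 'a \<times> 'a \<Rightarrow> 'a \<times> 'a \<times> 'a) set" where
  "markoff_moves =
    {\<lambda>(x, y, z). (y * z - x, y, z),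
     \<lambda>(x, y, z). (x, x * z - y, z),
     \<lambda>(x, y, z). (x, y, x * y - z)}"

definition coordinate_permutations :: "('a \<times> 'a \<times> 'a \<Rightarrow> 'a \<times> 'a \<times> 'a) set" where
  "coordinate_permutations =
    {\<lambda>(x, y, z). (x, y, z), \<lambda>(x, y, z). (x, z, y), \<lambda>(x, y, z). (y, x, z),
     \<lambda>(x, y, z). (y, z, x), \<lambda>(x, y, z). (z, x, y), \<lambda>(x, y, z). (z, y, x)}"

text \<open>Elements of \<^const>\<open>Bij\<close> are extensional, so the generators have to be restricted to the
  solution set.\<close>

definition cayley_generators :: "('a::field \<times> 'a \<times> 'a \<Rightarrow> 'a \<times> 'a \<times> 'a) set" where
  "cayley_generators =
    (\<lambda>m. restrict m cayley_solutions) ` (markoff_moves \<union> coordinate_permutations)"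

definition cayley_group :: "('a::field \<times> 'a \<times> 'a \<Rightarrow> 'a \<times> 'a \<times> 'a) monoid" where
  "cayley_group = (BijGroup cayley_solutions)
     \<lparr>carrier := generate (BijGroup cayley_solutions) cayley_generators\<rparr>"

definition cayley_orbits :: "('a::field \<times> 'a \<times> 'a) set set" where
  "cayley_orbits = orbits cayley_group cayley_solutions (\<lambda>g. g)"

definition eps :: "nat \<Rightarrow> int" where
  "eps p = (-1) ^ ((p - 1) div 2)"

definition expo :: "nat \<Rightarrow> nat \<Rightarrow> nat" where
  "expo p q = multiplicity q (p\<^sup>2 - 1)"

definition Q_plus :: "nat \<Rightarrow> nat set" where
  "Q_plus p = {q. prime q \<and> odd q \<and> int q dvd int p + eps p}"

definition Q_minus :: "nat \<Rightarrow> nat set" where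
  "Q_minus p = {q. prime q \<and> odd q \<and> int q dvd int p - eps p}"

definition D_set :: "nat \<Rightarrow> nat set" where
  "D_set p = {t. t dvd p\<^sup>2 - 1 \<and> (p + 1 dvd t \<or> p - 1 dvd t)}"

definition size_expr :: "nat \<Rightarrow> nat \<Rightarrow> real" where
  "size_expr p t =
    1 / 2 * (\<Prod>q | prime q \<and> q dvd p\<^sup>2 - 1 \<and> multiplicity q t < expo p q.
               ((real q)\<^sup>2 - 1) * real q ^ (2 * (expo p q - multiplicity q t - 1)))"

lemma cayley_generators_subset_Bij:
  "cayley_generators \<subseteq> Bij (cayley_solutions :: ('a::field \<times> 'a \<times> 'a) set)"
proof -
  let ?S = "cayley_solutions :: ('a \<times> 'a \<times> 'a) set"
  have *: "restrict f ?S \<in> Bij ?S"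
    if "\<And>s. s \<in> ?S \<Longrightarrow> f s \<in> ?S" "\<And>s. s \<in> ?S \<Longrightarrow> g s \<in> ?S"
       "\<And>s. g (f s) = s" "\<And>s. f (g s) = s" for f g
  proof -
    have "bij_betw f ?S ?S"
      by (rule bij_betw_byWitness[where f' = g]) (use that in auto)
    then show ?thesis by (simp add: Bij_def)
  qed
  have "restrict m ?S \<in> Bij ?S" if "m \<in> markoff_moves" for m
    by (rule *[where g = m]; use that in
        \<open>auto simp: markoff_moves_def cayley_solutions_def algebra_simps power2_eq_square\<close>)
  moreover have "restrict m ?S \<in> Bij ?S" if m: "m \<in> coordinate_permutations" for m
  proof -
    obtain g where g: "g \<in> coordinate_permutations" "\<And>s. g (m s) = s" "\<And>s. m (g s) = s"
    proof -
      from m have "m = (\<lambda>(x, y, z). (y, z, x)) \<or> m = (\<lambda>(x, y, z). (z, x, y)) \<or> (\<forall>s. m (m s) = s)"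
        unfolding coordinate_permutations_def by auto
      then show ?thesis
      proof (elim disjE)
        assume "m = (\<lambda>(x, y, z). (y, z, x))"
        then show ?thesis
          by (intro that[of "\<lambda>(x, y, z). (z, x, y)"]) (auto simp: coordinate_permutations_def)
      next
        assume "m = (\<lambda>(x, y, z). (z, x, y))"
        then show ?thesis
          by (intro that[of "\<lambda>(x, y, z). (y, z, x)"]) (auto simp: coordinate_permutations_def)
      next
        assume "\<forall>s. m (m s) = s"
        then show ?thesis using m by (intro that[of m]) auto
      qed
    qed
    have "f s \<in> ?S" if "f \<in> coordinate_permutations" "s \<in> ?S" for f s
      using that by (auto simp: coordinate_permutations_def cayley_solutions_def algebra_simps)
    then show ?thesis using g m by (intro *[where g = g]) auto
  qed
  ultimately show ?thesis by (auto simp: cayley_generators_def)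
qed

end

theory Submission
  imports Defs "HOL-Algebra.Algebraic_Closure_Type" "HOL-Number_Theory.Residues"
begin

text \<open>
  Over the algebraic closure the cubic is parametrised by \<open>(u + 1/u, v + 1/v, uv + 1/(uv))\<close>, uniquely
  up to \<open>(u, v) \<mapsto> (1/u, 1/v)\<close>, and the triple is rational iff \<open>u\<close> and \<open>v\<close> both lie in the
  \<open>(p-1)\<close>-th or both in the \<open>(p+1)\<close>-th roots of unity. Writing \<open>u = g\<^sup>a\<close>, \<open>v = g\<^sup>b\<close> for a primitive
  \<open>(p\<^sup>2 - 1)\<close>-th root of unity \<open>g\<close>, Markoff moves and permutations generate the action of
  \<open>GL\<^sub>2(\<int>)\<close> on the exponents \<open>(a, b)\<close> modulo \<open>p\<^sup>2 - 1\<close>. By the Euclidean algorithm the orbit of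
  \<open>(a, b)\<close> is that of \<open>(t, 0)\<close> with \<open>t = gcd(a, b, p\<^sup>2 - 1)\<close>, which is also an invariant. The orbit of
  index \<open>t\<close> has \<open>J\<^sub>2((p\<^sup>2 - 1)/t)\<close> exponent pairs, and negation identifies them in twos unless
  \<open>(p\<^sup>2 - 1)/t\<close> is 1 or 2.
\<close>

(* HOL-Algebra's prime would otherwise shadow the number-theoretic one. *)
hide_const (open) Divisibility.prime

subsection \<open>Divisor counts and Jordan's totient\<close>

text \<open>Every divisor of either side divides \<open>d\<close>, so only common divisors among
  those need comparing. This covers both reduction of \<open>a\<close> and \<open>b\<close> modulo
  \<open>d\<close> and invertible linear changes of the pair.\<close>

lemma gcd_gcd_eqI:
  fixes d :: "'a :: semiring_gcd"
  assumes "\<And>x. x dvd d \<Longrightarrow> x dvd a \<and> x dvd b \<longleftrightarrow> x dvd a' \<and> x dvd b'"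
  shows "gcd (gcd a b) d = gcd (gcd a' b') d"
proof -
  have *: "gcd (gcd x y) d dvd x" "gcd (gcd x y) d dvd y" "gcd (gcd x y) d dvd d" for x y
    by (rule dvd_trans[OF gcd_dvd1 gcd_dvd1], rule dvd_trans[OF gcd_dvd1 gcd_dvd2], rule gcd_dvd2)
  have "gcd (gcd a b) d dvd gcd (gcd a' b') d"
    using assms[of "gcd (gcd a b) d"] * by (metis gcd_greatest)
  moreover have "gcd (gcd a' b') d dvd gcd (gcd a b) d"
    using assms[of "gcd (gcd a' b') d"] * by (metis gcd_greatest)
  ultimately show ?thesis by (rule associated_eqI) simp_all
qed

text \<open>Induction on the set of primes: a divisor of \<open>q ^ e q * m\<close> with
  \<open>q\<close> not dividing \<open>m\<close> splits uniquely as \<open>q ^ i * d\<close> with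
  \<open>i \<le> e q\<close> and \<open>d dvd m\<close>.\<close>

lemma card_divisors_prod_prime_powers:
  fixes e :: "nat \<Rightarrow> nat"
  assumes "finite A" "\<And>q. q \<in> A \<Longrightarrow> prime q"
  shows "card {d. d dvd (\<Prod>q\<in>A. q ^ e q)} = (\<Prod>q\<in>A. e q + 1)"
  using assms
proof (induction A rule: finite_induct)
  case empty
  have "{d::nat. d dvd 1} = {1}" by auto
  then show ?case by simp
next
  case (insert q A)
  define m where "m = (\<Prod>q\<in>A. q ^ e q)"
  have q: "prime q" using insert.prems by simp
  have m0: "m \<noteq> 0" using insert.prems[of 0] insert.hyps by (auto simp: m_def)
  have ndvd: "\<not> q dvd m"
  proof
    assume "q dvd m"
    then obtain r where "r \<in> A" "q dvd r ^ e r"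
      using q insert.hyps by (auto simp: m_def prime_dvd_prod_iff)
    then have "q dvd r" using q prime_dvd_power by blast
    then have "q = r" using q insert.prems \<open>r \<in> A\<close> by (simp add: primes_dvd_imp_eq)
    then show False using insert.hyps \<open>r \<in> A\<close> by simp
  qed
  \<comment> \<open>The exponent \<open>i\<close> can be read off from the product, which gives
    injectivity below.\<close>
  have mult: "multiplicity q (q ^ i * d) = i" if "d dvd m" for i d
  proof -
    have "\<not> q dvd d" using that ndvd dvd_trans by blast
    moreover have "d \<noteq> 0" using that m0 by auto
    ultimately show ?thesis using q
      by (subst prime_elem_multiplicity_mult_distrib)
         (auto simp: not_dvd_imp_multiplicity_0)
  qed
  have "bij_betw (\<lambda>(i, d). q ^ i * d) ({..e q} \<times> {d. d dvd m}) {d. d dvd q ^ e q * m}"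
    unfolding bij_betw_def
  proof (intro conjI equalityI subsetI)
    show "inj_on (\<lambda>(i, d). q ^ i * d) ({..e q} \<times> {d. d dvd m})"
    proof (rule inj_onI, clarify)
      fix i d i' d' assume h: "d dvd m" "d' dvd m" "q ^ i * d = q ^ i' * d'"
      then have "i = i'" using mult by metis
      then show "i = i' \<and> d = d'" using h q by (auto simp: prime_gt_0_nat)
    qed
    fix x assume "x \<in> {d. d dvd q ^ e q * m}"
    then obtain b c where "x = b * c" "b dvd q ^ e q" "c dvd m"
      using division_decomp by blast
    moreover from this obtain i where "i \<le> e q" "b = q ^ i"
      using q by (auto simp: divides_primepow_nat)
    ultimately show "x \<in> (\<lambda>(i, d). q ^ i * d) ` ({..e q} \<times> {d. d dvd m})" by auto
  next
    fix x assume "x \<in> (\<lambda>(i, d). q ^ i * d) ` ({..e q} \<times> {d. d dvd m})"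
    then show "x \<in> {d. d dvd q ^ e q * m}"
      by (auto intro!: mult_dvd_mono le_imp_power_dvd)
  qed
  then have "card {d. d dvd q ^ e q * m} = card ({..e q} \<times> {d. d dvd m})"
    by (simp add: bij_betw_same_card)
  then show ?case using insert by (simp add: m_def card_cartesian_product)
qed

text \<open>Jordan's totient J_2, the analogue of Euler's phi for pairs, as a product over primes in
  the shape of \<open>size_expr\<close>. Real values keep \<open>q^2 - 1\<close> free of truncated
  subtraction.\<close>

definition jordan_totient :: "nat \<Rightarrow> real" where
  "jordan_totient d =
    (\<Prod>q\<in>prime_factors d. ((real q)\<^sup>2 - 1) * real q ^ (2 * (multiplicity q d - 1)))"

definition primitive_pairs :: "nat \<Rightarrow> (nat \<times> nat) set" where
  "primitive_pairs d = {(a, b). a < d \<and> b < d \<and> gcd (gcd a b) d = 1}"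

lemma finite_primitive_pairs [simp]: "finite (primitive_pairs d)"
  by (rule finite_subset[of _ "{..<d} \<times> {..<d}"]) (auto simp: primitive_pairs_def)

text \<open>Only the factor at \<open>q\<close> is affected: its exponent goes up by one, or it
  appears for the first time. The count of primitive pairs obeys the same recursion.\<close>

lemma jordan_totient_prime_mult:
  assumes "prime q" "d > 0"
  shows "jordan_totient (q * d) =
    (if q dvd d then (real q)\<^sup>2 else (real q)\<^sup>2 - 1) * jordan_totient d"
proof -
  let ?f = "\<lambda>n r. ((real r)\<^sup>2 - 1) * real r ^ (2 * (multiplicity r n - 1))"
  have other: "?f (q * d) r = ?f d r" if "r \<in> prime_factors d - {q}" for r
  proof -
    have "multiplicity r (q * d) = multiplicity r d"
      using that assms
      by (subst prime_elem_multiplicity_mult_distrib)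
         (auto simp: prime_multiplicity_other in_prime_factors_iff)
    then show ?thesis by simp
  qed
  have mq: "multiplicity q (q * d) = Suc (multiplicity q d)"
    using assms by (intro multiplicity_times_same) auto
  have pf: "prime_factors (q * d) = insert q (prime_factors d - {q})"
    using assms by (auto simp: prime_factors_product prime_prime_factors)
  have "jordan_totient (q * d) = ?f (q * d) q * (\<Prod>r\<in>prime_factors d - {q}. ?f (q * d) r)"
    unfolding jordan_totient_def pf by (subst prod.insert) auto
  also have "(\<Prod>r\<in>prime_factors d - {q}. ?f (q * d) r) = (\<Prod>r\<in>prime_factors d - {q}. ?f d r)"
    by (rule prod.cong[OF refl other])
  also have "?f (q * d) q * \<dots> =
    (if q dvd d then (real q)\<^sup>2 else (real q)\<^sup>2 - 1) * jordan_totient d"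
  proof (cases "q dvd d")
    case True
    then have "q \<in> prime_factors d" using assms by (auto simp: in_prime_factors_iff)
    moreover have "multiplicity q d > 0"
      using True assms by (subst prime_multiplicity_gt_zero_iff) auto
    ultimately show ?thesis using True mq
      unfolding jordan_totient_def
      by (subst (2) prod.remove[of _ q]) (auto simp: power2_eq_square gr0_conv_Suc)
  next
    case False
    then have "q \<notin> prime_factors d" "multiplicity q d = 0"
      by (auto simp: in_prime_factors_iff not_dvd_imp_multiplicity_0)
    then show ?thesis using False mq unfolding jordan_totient_def by simp
  qed
  finally show ?thesis .
qed

text \<open>Primitivity modulo \<open>d\<close> depends only on residues modulo \<open>d\<close>,
  and each residue has \<open>q\<close> lifts below \<open>q * d\<close> in each coordinate.
  Division with remainder by \<open>d\<close> is the bijection.\<close>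

lemma card_primitive_pairs_lift:
  assumes "d > 0"
  shows "card {(a, b). a < q * d \<and> b < q * d \<and> gcd (gcd a b) d = 1}
    = q\<^sup>2 * card (primitive_pairs d)"
proof -
  let ?S = "{(a, b). a < q * d \<and> b < q * d \<and> gcd (gcd a b) d = 1}"
  let ?T = "({..<q} \<times> {..<q}) \<times> primitive_pairs d"
  have gm: "gcd (gcd (i * d + a) (j * d + b)) d = gcd (gcd a b) d" for i j a b :: nat
    by (rule gcd_gcd_eqI) (auto simp: dvd_add_right_iff)
  have gm': "gcd (gcd (a mod d) (b mod d)) d = gcd (gcd a b) d" for a b :: nat
    by (rule gcd_gcd_eqI) (auto simp: dvd_mod_iff)
  have lt: "i * d + a < q * d" if "i < q" "a < d" for i a :: nat
  proof -
    have "i * d + a < (i + 1) * d" using that by simp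
    also have "\<dots> \<le> q * d" using that by (intro mult_right_mono) auto
    finally show ?thesis .
  qed
  have "bij_betw (\<lambda>((i, j), (a, b)). (i * d + a, j * d + b)) ?T ?S"
    by (rule bij_betw_byWitness[where f' = "\<lambda>(a, b). ((a div d, b div d), (a mod d, b mod d))"])
       (use assms in \<open>auto simp: primitive_pairs_def less_mult_imp_div_less gm[simplified] gm'[simplified] lt\<close>)
  from bij_betw_same_card[OF this] show ?thesis
    by (simp add: card_cartesian_product power2_eq_square)
qed

text \<open>Induction on prime factors. A lift to \<open>q * d\<close> of a pair primitive modulo
  \<open>d\<close> stays primitive unless \<open>q\<close> divides both entries. That cannot happen
  if \<open>q dvd d\<close>; otherwise such lifts are as many as the primitive pairs modulo
  \<open>d\<close>.\<close>

lemma card_primitive_pairs: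
  assumes "d > 0"
  shows "real (card (primitive_pairs d)) = jordan_totient d"
  using assms
proof (induction d rule: prime_divisors_induct)
  case zero
  then show ?case by simp
next
  case (unit x)
  then have "primitive_pairs x = {(0, 0)}" by (auto simp: primitive_pairs_def)
  then show ?case using unit by (simp add: jordan_totient_def)
next
  case (factor q d)
  then have d: "d > 0" by simp
  let ?S = "{(a, b). a < q * d \<and> b < q * d \<and> gcd (gcd a b) d = 1}"
  have fin: "finite ?S"
    by (rule finite_subset[of _ "{..<q * d} \<times> {..<q * d}"]) auto
  note S = card_primitive_pairs_lift[OF d, of q]
  show ?case
  proof (cases "q dvd d")
    case True
    have "gcd (gcd a b) (q * d) = 1 \<longleftrightarrow> gcd (gcd a b) d = 1" for a b
    proof -
      have "coprime x q" if "coprime x d" for x by (rule coprime_divisors[OF dvd_refl True that])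
      then show ?thesis unfolding coprime_iff_gcd_eq_1[symmetric] by auto
    qed
    then have "primitive_pairs (q * d) = ?S" by (auto simp: primitive_pairs_def)
    then show ?thesis using S factor True d
      by (simp add: jordan_totient_prime_mult)
  next
    case False
    have q0: "q > 0" by (rule prime_gt_0_nat[OF factor(1)])
    have "coprime q d" by (rule prime_imp_coprime[OF factor(1) False])
    \<comment> \<open>The lifts to be discarded. As \<open>q\<close> is a unit modulo
      \<open>d\<close>, multiplication by \<open>q\<close> preserves primitivity modulo
      \<open>d\<close>, so they are exactly the \<open>q\<close>-multiples of primitive
      pairs.\<close>
    define B where "B = (\<lambda>(a, b). (q * a, q * b)) ` primitive_pairs d"
    define S where "S = ?S"
    have S_iff: "(a, b) \<in> S \<longleftrightarrow> a < q * d \<and> b < q * d \<and> gcd (gcd a b) d = 1" for a b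
      unfolding S_def by simp
    have P_iff: "(a, b) \<in> primitive_pairs n \<longleftrightarrow> a < n \<and> b < n \<and> gcd (gcd a b) n = 1" for a b n
      unfolding primitive_pairs_def by simp
    have g: "gcd (gcd (q * a) (q * b)) d = gcd (gcd a b) d" for a b
    proof (rule gcd_gcd_eqI)
      fix x assume "x dvd d"
      then have "coprime q x" by (rule coprime_divisors[OF dvd_refl _ \<open>coprime q d\<close>])
      then have "coprime x q" by (simp add: coprime_commute)
      then show "x dvd q * a \<and> x dvd q * b \<longleftrightarrow> x dvd a \<and> x dvd b"
        by (simp add: coprime_dvd_mult_right_iff)
    qed
    have cop: "gcd (gcd a b) (q * d) = 1 \<longleftrightarrow> gcd (gcd a b) d = 1 \<and> \<not> (q dvd a \<and> q dvd b)" for a b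
    proof -
      have "coprime (gcd a b) q \<longleftrightarrow> \<not> q dvd gcd a b"
        using prime_imp_coprime[OF factor(1), of "gcd a b"] not_prime_unit[of q] factor(1)
          coprime_common_divisor[of "gcd a b" q q]
        by (auto simp: coprime_commute)
      then show ?thesis unfolding coprime_iff_gcd_eq_1[symmetric] by auto
    qed
    have B_iff: "(a, b) \<in> B \<longleftrightarrow> (a, b) \<in> S \<and> q dvd a \<and> q dvd b" for a b
    proof
      assume "(a, b) \<in> B"
      then obtain a' b' where P: "(a', b') \<in> primitive_pairs d" and eq: "a = q * a'" "b = q * b'"
        unfolding B_def by auto
      show "(a, b) \<in> S \<and> q dvd a \<and> q dvd b"
        using P[unfolded P_iff] q0 unfolding S_iff eq g by simp
    next
      assume ab: "(a, b) \<in> S \<and> q dvd a \<and> q dvd b"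
      then obtain a' b' where eq: "a = q * a'" "b = q * b'" unfolding dvd_def by blast
      then have "(a', b') \<in> primitive_pairs d"
        using ab[unfolded eq S_iff g] q0 unfolding P_iff by simp
      then show "(a, b) \<in> B" unfolding B_def eq by force
    qed
    have PB: "(a, b) \<in> primitive_pairs (q * d) \<longleftrightarrow> (a, b) \<in> S - B" for a b
      unfolding P_iff Diff_iff B_iff S_iff cop by argo
    have "primitive_pairs (q * d) = S - B" by (rule Set.set_eqI) (metis surj_pair PB)
    moreover have "B \<subseteq> S" by (rule subsetI) (metis surj_pair B_iff)
    moreover have "card B = card (primitive_pairs d)"
      unfolding B_def by (rule card_image) (use q0 in \<open>auto simp: inj_on_def\<close>)
    moreover have "finite S" using fin unfolding S_def .
    ultimately have "card (primitive_pairs (q * d)) + card (primitive_pairs d) = card S"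
      using card_Diff_subset[of B S] card_mono[of S B] finite_subset[of B S] by simp
    also have "card S = q\<^sup>2 * card (primitive_pairs d)" unfolding S_def by (rule S)
    also have "real \<dots> = (real q)\<^sup>2 * card (primitive_pairs d)" by simp
    finally have "real (card (primitive_pairs (q * d))) + card (primitive_pairs d)
      = (real q)\<^sup>2 * card (primitive_pairs d)" by simp
    then show ?thesis using factor False d
      by (simp add: jordan_totient_prime_mult left_diff_distrib)
  qed
qed

section \<open>Factorization and divisors of p + 1 and p - 1\<close>

text \<open>An odd prime dividing \<open>m\<close> does not divide \<open>m'\<close>, so its
  exponent in \<open>m\<close> is its exponent in \<open>m * m'\<close>. In the application
  \<open>m\<close> and \<open>m'\<close> are p + 1 and p - 1 in some order, and the exponents become
  \<open>expo p q\<close>.\<close>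

lemma even_eq_prod_prime_powers:
  fixes m m' :: nat
  assumes "even m" "m > 0" "m' > 0"
    and cop: "\<And>q. prime q \<Longrightarrow> odd q \<Longrightarrow> q dvd m \<Longrightarrow> \<not> q dvd m'"
  shows "m = 2 ^ multiplicity 2 m * (\<Prod>q | prime q \<and> odd q \<and> q dvd m. q ^ multiplicity q (m * m'))"
    (is "_ = _ * prod ?f ?Q")
proof -
  have pf: "prime_factors m = insert 2 ?Q"
    using assms(1,2) primes_dvd_imp_eq[of "2 :: nat"] by (auto simp: in_prime_factors_iff)
  have fin: "finite ?Q"
    by (rule finite_subset[of _ "prime_factors m"]) (unfold pf, rule subset_insertI, simp flip: pf)
  have "m = (\<Prod>q\<in>prime_factors m. q ^ multiplicity q m)"
    by (rule prime_factorization_nat[OF assms(2)])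
  also have "\<dots> = 2 ^ multiplicity 2 m * (\<Prod>q\<in>?Q. q ^ multiplicity q m)"
    unfolding pf using fin by (subst prod.insert) auto
  also have "(\<Prod>q\<in>?Q. q ^ multiplicity q m) = prod ?f ?Q"
  proof (rule prod.cong[OF refl])
    fix q assume q: "q \<in> ?Q"
    then have "multiplicity q m' = 0" using cop[of q] by (auto intro: not_dvd_imp_multiplicity_0)
    then have "multiplicity q (m * m') = multiplicity q m"
      using q assms(2,3) by (simp add: prime_elem_multiplicity_mult_distrib)
    then show "q ^ multiplicity q m = q ^ multiplicity q (m * m')" by simp
  qed
  finally show ?thesis .
qed

lemma card_divisors_even:
  fixes m m' :: nat
  assumes "even m" "m > 0" "m' > 0"
    and cop: "\<And>q. prime q \<Longrightarrow> odd q \<Longrightarrow> q dvd m \<Longrightarrow> \<not> q dvd m'"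
  shows "card {d. d dvd m} =
    (multiplicity 2 m + 1) * (\<Prod>q | prime q \<and> odd q \<and> q dvd m. multiplicity q (m * m') + 1)"
proof -
  let ?Q = "{q. prime q \<and> odd q \<and> q dvd m}"
  \<comment> \<open>The prime 2 may divide both \<open>m\<close> and \<open>m'\<close>, so its
    exponent is taken in \<open>m\<close> alone.\<close>
  define e where "e q = (if q = 2 then multiplicity 2 m else multiplicity q (m * m'))" for q :: nat
  have fin: "finite ?Q"
    by (rule finite_subset[of _ "{..m}"]) (use assms(2) in \<open>auto dest: dvd_imp_le\<close>)
  \<comment> \<open>With \<open>h\<close> left open, the same splitting off of the prime 2 serves
    the factorization and the divisor count.\<close>
  have eq: "(\<Prod>q\<in>insert 2 ?Q. h q (e q)) = h 2 (multiplicity 2 m) * (\<Prod>q\<in>?Q. h q (multiplicity q (m * m')))"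
    for h :: "nat \<Rightarrow> nat \<Rightarrow> nat"
  proof -
    have "(\<Prod>q\<in>insert 2 ?Q. h q (e q)) = h 2 (e 2) * (\<Prod>q\<in>?Q. h q (e q))"
      using fin by (subst prod.insert) auto
    also have "(\<Prod>q\<in>?Q. h q (e q)) = (\<Prod>q\<in>?Q. h q (multiplicity q (m * m')))"
      by (rule prod.cong) (auto simp: e_def)
    finally show ?thesis by (simp add: e_def)
  qed
  have "m = (\<Prod>q\<in>insert 2 ?Q. q ^ e q)"
    unfolding eq[of "\<lambda>q k. q ^ k"] by (rule even_eq_prod_prime_powers[OF assms])
  then have "card {d. d dvd m} = card {d. d dvd (\<Prod>q\<in>insert 2 ?Q. q ^ e q)}" by simp
  also have "\<dots> = (\<Prod>q\<in>insert 2 ?Q. e q + 1)"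
    by (rule card_divisors_prod_prime_powers) (use fin in auto)
  finally show ?thesis unfolding eq[of "\<lambda>q k. k + 1"] .
qed

lemma mult_image_divisors_iff:
  fixes c t :: nat
  assumes "c > 0"
  shows "t \<in> (\<lambda>d. c * d) ` {d. d dvd e} \<longleftrightarrow> t dvd c * e \<and> c dvd t"
proof
  assume "t dvd c * e \<and> c dvd t"
  then obtain d where d: "t = c * d" "t dvd c * e" by (metis dvdE)
  then have "d dvd e" using assms by simp
  then show "t \<in> (\<lambda>d. c * d) ` {d. d dvd e}" using d(1) by blast
qed auto

text \<open>Inclusion-exclusion: multiples of p + 1 dividing p^2 - 1 correspond to their cofactors,
  the divisors of p - 1, and likewise with the roles exchanged. Exactly two elements, p^2 - 1 and
  its half, are counted twice.\<close>

lemma card_D_set: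
  assumes "odd p" "p \<ge> 5"
  shows "card (D_set p) + 2 = card {d. d dvd p + 1} + card {d. d dvd p - 1}"
proof -
  have n: "p\<^sup>2 - 1 = (p + 1) * (p - 1)" by (simp add: power2_eq_square algebra_simps)
  have pos: "p - 1 > 0" "p + 1 > 0" using assms by simp_all
  define A where "A = (\<lambda>d. (p + 1) * d) ` {d. d dvd p - 1}"
  define B where "B = (\<lambda>d. (p - 1) * d) ` {d. d dvd p + 1}"
  have A_iff: "t \<in> A \<longleftrightarrow> t dvd p\<^sup>2 - 1 \<and> p + 1 dvd t" for t
    unfolding A_def n using mult_image_divisors_iff[OF pos(2)] .
  have B_iff: "t \<in> B \<longleftrightarrow> t dvd p\<^sup>2 - 1 \<and> p - 1 dvd t" for t
    unfolding B_def n mult.commute[of "p + 1"] using mult_image_divisors_iff[OF pos(1)] .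
  have D: "D_set p = A \<union> B" using A_iff B_iff by (auto simp: D_set_def)
  have fin: "finite A" "finite B" unfolding A_def B_def using pos by (simp_all add: finite_divisors_nat)
  have cA: "card A = card {d. d dvd p - 1}"
    unfolding A_def by (rule card_image, rule inj_onI) (use pos in \<open>simp only: mult_cancel1\<close>, simp)
  have cB: "card B = card {d. d dvd p + 1}"
    unfolding B_def by (rule card_image) (use pos in \<open>auto simp: inj_on_def\<close>)
  obtain h where h: "p - 1 = 2 * h" using assms(1) by (metis dvdE odd_two_times_div_two_nat)
  have p1: "p + 1 = 2 * (h + 1)" using h assms by simp
  have half: "(p\<^sup>2 - 1) div 2 = (p + 1) * h" "(p\<^sup>2 - 1) div 2 = (p - 1) * (h + 1)"
    unfolding n h p1 by simp_all
  have "A \<inter> B = {p\<^sup>2 - 1, (p\<^sup>2 - 1) div 2}"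
  proof (intro equalityI subsetI)
    fix t assume t: "t \<in> A \<inter> B"
    then obtain d where d: "t = (p + 1) * d" unfolding A_def by auto
    \<comment> \<open>Since p + 1 is 2 modulo p - 1, divisibility of \<open>t\<close> by p - 1
      passes to \<open>2 * d\<close>, and multiplying by p + 1 gives that p^2 - 1 divides
      \<open>2 * t\<close>.\<close>
    have "p + 1 = (p - 1) + 2" using assms by simp
    then have "t = (p - 1) * d + 2 * d" unfolding d by (simp only: add_mult_distrib)
    moreover have "p - 1 dvd t" using t B_iff by blast
    ultimately have "p - 1 dvd 2 * d" by (metis dvd_add_right_iff dvd_triv_left)
    then have "(p + 1) * (p - 1) dvd (p + 1) * (2 * d)" by (rule mult_dvd_mono[OF dvd_refl])
    then have *: "p\<^sup>2 - 1 dvd 2 * t" unfolding n d by (simp only: mult.left_commute)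
    obtain e where e: "p\<^sup>2 - 1 = t * e" using t A_iff unfolding dvd_def by blast
    have "t * e > 0" unfolding e[symmetric] n using pos by simp
    then have "t > 0" "e > 0" by simp_all
    moreover have "e dvd 2" using * \<open>t > 0\<close> unfolding e by (simp add: mult.commute)
    ultimately have "e = 1 \<or> e = 2" by (auto dest: dvd_imp_le)
    then show "t \<in> {p\<^sup>2 - 1, (p\<^sup>2 - 1) div 2}" unfolding e by auto
  next
    fix t assume "t \<in> {p\<^sup>2 - 1, (p\<^sup>2 - 1) div 2}"
    moreover have "p\<^sup>2 - 1 \<in> A \<inter> B"
      unfolding Int_iff A_iff B_iff n by (simp only: dvd_triv_left dvd_triv_right dvd_refl simp_thms)
    moreover have "(p\<^sup>2 - 1) div 2 \<in> A" unfolding half(1) A_def h by simp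
    moreover have "(p\<^sup>2 - 1) div 2 \<in> B"
      unfolding half(2) B_def p1 by (rule imageI) (simp only: mem_Collect_eq dvd_triv_right)
    ultimately show "t \<in> A \<inter> B" by auto
  qed
  moreover have "p\<^sup>2 - 1 \<noteq> (p\<^sup>2 - 1) div 2"
  proof -
    have "p\<^sup>2 - 1 > 0" unfolding n using pos by simp
    then show ?thesis by simp
  qed
  ultimately have "card (A \<inter> B) = 2" by simp
  then show ?thesis using card_Un_Int[OF fin] cA cB D by simp
qed

subsection \<open>Roots of unity\<close>

text \<open>A root of 1 + z + ... + z^(q-1) is a \<open>q\<close>-th root of unity. It is not 1,
  where this polynomial takes the nonzero value \<open>q\<close>.\<close>

lemma prime_root_of_unity_exists:
  assumes "prime q" "of_nat q \<noteq> (0 :: 'k :: alg_closed_field)"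
  shows "\<exists>z :: 'k. z \<noteq> 1 \<and> z ^ q = 1"
proof -
  have q: "q \<ge> 2" using assms prime_ge_2_nat by blast
  then obtain z :: 'k where z: "(\<Sum>k\<le>q - 1. 1 * z ^ k) = 0"
    using alg_closed[of "q - 1" "\<lambda>_. 1"] by auto
  have "{..q - 1} = {..<q}" using q by auto
  then have s: "(\<Sum>k<q. z ^ k) = 0" using z by simp
  have "z ^ q - 1 = (z - 1) * (\<Sum>k<q. z ^ k)" by (simp add: power_diff_1_eq)
  then have "z ^ q = 1" using s by simp
  moreover have "z \<noteq> 1" using s assms(2) by auto
  ultimately show ?thesis by blast
qed

text \<open>The order grows by one prime at a time: if \<open>q dvd n\<close>, a \<open>q\<close>-th
  root of \<open>g\<close> works; otherwise \<open>g\<close> is multiplied by a nontrivial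
  \<open>q\<close>-th root of unity.\<close>

lemma primitive_root_of_unity_exists:
  assumes "n > 0" "of_nat n \<noteq> (0 :: 'k :: alg_closed_field)"
  shows "\<exists>g :: 'k. \<forall>k. g ^ k = 1 \<longleftrightarrow> n dvd k"
  using assms
proof (induction n rule: prime_divisors_induct)
  case zero
  then show ?case by simp
next
  case (unit x)
  then show ?case by (auto intro!: exI[of _ 1])
next
  case (factor q n)
  then obtain g :: 'k where g: "g ^ k = 1 \<longleftrightarrow> n dvd k" for k by auto
  have q0: "q > 0" using factor by auto
  show ?case
  proof (cases "q dvd n")
    case True
    obtain h where h: "h ^ q = g" using nth_root_exists[of q g] q0 by blast
    have "h ^ k = 1 \<longleftrightarrow> q * n dvd k" for k
    proof
      assume k: "h ^ k = 1"
      \<comment> \<open>The \<open>q\<close>-th power first yields \<open>n dvd k\<close>, hence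
        \<open>q dvd k\<close>; only then is \<open>h ^ k\<close> itself a power of
        \<open>g\<close>.\<close>
      have "g ^ k = (h ^ k) ^ q" by (simp add: h[symmetric] power_mult[symmetric] mult.commute)
      then have "n dvd k" using g k by simp
      then obtain l where l: "k = q * l" using True by (meson dvd_def dvd_trans)
      then have "g ^ l = 1" using k h by (simp add: power_mult)
      then show "q * n dvd k" using g l by simp
    next
      assume "q * n dvd k"
      then obtain l where "k = q * (n * l)" by (auto simp: dvd_def mult.assoc)
      then have "h ^ k = g ^ (n * l)" using h by (simp add: power_mult)
      then show "h ^ k = 1" using g by simp
    qed
    then show ?thesis by blast
  next
    case False
    have "of_nat q \<noteq> (0::'k)" using factor.prems by auto
    then obtain z :: 'k where z: "z \<noteq> 1" "z ^ q = 1"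
      using prime_root_of_unity_exists[OF factor(1)] by blast
    \<comment> \<open>If \<open>q\<close> did not divide \<open>k\<close>, Bezout would express
      \<open>z\<close> through powers of \<open>z ^ k\<close> and \<open>z ^ q\<close>, forcing
      \<open>z = 1\<close>.\<close>
    have zk: "z ^ k = 1 \<Longrightarrow> q dvd k" for k
    proof (rule ccontr)
      assume k: "z ^ k = 1" "\<not> q dvd k"
      then have "coprime k q" using prime_imp_coprime[OF factor(1)] coprime_commute by blast
      then have "gcd k q = 1" by simp
      moreover have "k \<noteq> 0" using k(2) by (metis dvd_0_right)
      ultimately obtain x y where "k * x = q * y + 1"
        using bezout_nat[of k q] by metis
      then have "(z ^ k) ^ x = (z ^ q) ^ y * z" by (simp flip: power_mult power_add)
      then show False using k z by simp
    qed
    have cop: "coprime q n" by (rule prime_imp_coprime[OF factor(1) False])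
    have "(g * z) ^ k = 1 \<longleftrightarrow> q * n dvd k" for k
    proof
      assume k: "(g * z) ^ k = 1"
      \<comment> \<open>The \<open>q\<close>-th power removes \<open>z\<close> and isolates the
        condition on \<open>g\<close>.\<close>
      have "1 = ((g * z) ^ q) ^ k" using k by (metis mult.commute power_mult power_one)
      also have "(g * z) ^ q = g ^ q" using z by (simp add: power_mult_distrib)
      finally have "n dvd q * k" using g[of "q * k"] by (simp add: power_mult)
      then have n: "n dvd k" using cop by (simp add: coprime_commute coprime_dvd_mult_right_iff)
      then have "z ^ k = 1" using k g[of k] by (simp add: power_mult_distrib)
      then show "q * n dvd k" using n zk cop by (simp add: divides_mult)
    next
      assume k: "q * n dvd k"
      have "g ^ k = 1" using g k dvd_mult_right by blast
      moreover have "z ^ k = 1" using k z by (auto elim!: dvdE simp: power_mult)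
      ultimately show "(g * z) ^ k = 1" by (simp add: power_mult_distrib)
    qed
    then show ?thesis by blast
  qed
qed

text \<open>The powers of \<open>g\<close> with exponents below \<open>n\<close> are
  \<open>n\<close> distinct roots of X^n - 1, which has at most \<open>n\<close> roots.\<close>

lemma root_of_unity_eq_power:
  fixes g u :: "'k :: field"
  assumes g: "\<And>k. g ^ k = 1 \<longleftrightarrow> n dvd k" and "n > 0" and u: "u ^ n = 1"
  shows "\<exists>k. u = g ^ k"
proof -
  have g0: "g \<noteq> 0" using g[of n] assms(2) by (auto simp: power_0_left)
  have le: "i = j" if "g ^ i = g ^ j" "i \<le> j" "j < n" for i j
  proof -
    have "g ^ j = g ^ i * g ^ (j - i)" using that by (metis le_add_diff_inverse power_add)
    then have "g ^ (j - i) = 1" using that g0 by simp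
    then have "n dvd j - i" using g by simp
    then show ?thesis using that by (auto dest: dvd_imp_le)
  qed
  have "inj_on (\<lambda>k. g ^ k) {..<n}"
    by (rule inj_onI) (metis le lessThan_iff nat_le_linear)
  then have c: "card ((\<lambda>k. g ^ k) ` {..<n}) = n" by (simp add: card_image)
  let ?P = "monom 1 n - 1 :: 'k poly"
  have "coeff ?P n = 1" using assms(2) by (simp add: coeff_monom)
  then have P0: "?P \<noteq> 0" by (metis coeff_0 zero_neq_one)
  have eq: "{x. poly ?P x = 0} = {x. x ^ n = 1}" by (simp add: poly_monom)
  have "degree ?P \<le> n" by (rule degree_diff_le) (auto simp: degree_monom_le)
  then have "card {x :: 'k. x ^ n = 1} \<le> n"
    using card_poly_roots_bound[OF P0] eq by simp
  moreover have "finite {x :: 'k. x ^ n = 1}" using poly_roots_finite[OF P0] eq by simp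
  moreover have "(\<lambda>k. g ^ k) ` {..<n} \<subseteq> {x. x ^ n = 1}"
    using g by (auto simp flip: power_mult)
  ultimately have "(\<lambda>k. g ^ k) ` {..<n} = {x. x ^ n = 1}"
    using c by (metis card_seteq)
  then show ?thesis using u by auto
qed

subsection \<open>Orbits of the Markoff group\<close>

abbreviation cayley_orbit :: "'a::field \<times> 'a \<times> 'a \<Rightarrow> ('a \<times> 'a \<times> 'a) set" where
  "cayley_orbit \<equiv> orbit cayley_group (\<lambda>g. g)"

lemma subgroup_cayley_group:
  "subgroup (generate (BijGroup cayley_solutions) cayley_generators)
    (BijGroup (cayley_solutions :: ('a::field \<times> 'a \<times> 'a) set))"
  using cayley_generators_subset_Bij
  by (intro group.generate_is_subgroup group_BijGroup) (simp add: BijGroup_def)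

lemma group_action_cayley_group:
  "group_action cayley_group (cayley_solutions :: ('a::field \<times> 'a \<times> 'a) set) (\<lambda>g. g)"
proof -
  have "group (cayley_group :: ('a \<times> 'a \<times> 'a \<Rightarrow> 'a \<times> 'a \<times> 'a) monoid)"
    unfolding cayley_group_def
    by (rule subgroup.subgroup_is_group[OF subgroup_cayley_group group_BijGroup])
  moreover have "(\<lambda>g. g) \<in> hom cayley_group (BijGroup (cayley_solutions :: ('a \<times> 'a \<times> 'a) set))"
    using subgroup.subset[OF subgroup_cayley_group]
    by (auto simp: hom_def cayley_group_def)
  ultimately show ?thesis
    unfolding group_action_def group_hom_def group_hom_axioms_def
    by (simp add: group_BijGroup)
qed

lemma generator_in_orbit:
  assumes "m \<in> markoff_moves \<union> coordinate_permutations" "s \<in> cayley_solutions"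
  shows "m s \<in> cayley_orbit s"
proof -
  have "restrict m cayley_solutions \<in> carrier cayley_group"
    using assms(1) by (auto simp: cayley_group_def cayley_generators_def intro: generate.incl)
  moreover have "restrict m cayley_solutions s = m s" using assms(2) by simp
  ultimately show ?thesis unfolding orbit_def by (metis (mono_tags, lifting) mem_Collect_eq)
qed

lemma generator_maps_solutions:
  assumes "m \<in> markoff_moves \<union> coordinate_permutations" "s \<in> cayley_solutions"
  shows "m s \<in> cayley_solutions"
proof -
  have "restrict m cayley_solutions \<in> Bij cayley_solutions"
    using assms(1) cayley_generators_subset_Bij by (auto simp: cayley_generators_def)
  then show ?thesis using assms(2) by (auto simp: Bij_def bij_betw_def)
qed

lemma cayley_orbit_eqI:
  assumes "s \<in> cayley_solutions" "s' \<in> cayley_solutions" "s' \<in> cayley_orbit s"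
  shows "cayley_orbit s' = cayley_orbit s"
proof -
  interpret group_action cayley_group cayley_solutions "\<lambda>g. g"
    by (rule group_action_cayley_group)
  have sub: "x \<in> cayley_solutions" if "x \<in> cayley_orbit y" "y \<in> cayley_solutions" for x y
    using that element_image[of _ y x] unfolding orbit_def by auto
  have le: "cayley_orbit x \<subseteq> cayley_orbit y"
    if "x \<in> cayley_solutions" "y \<in> cayley_solutions" "x \<in> cayley_orbit y" for x y
  proof
    fix z assume z: "z \<in> cayley_orbit x"
    show "z \<in> cayley_orbit y"
      by (rule orbit_trans[OF that(2) that(1) sub[OF z that(1)] that(3) z])
  qed
  show ?thesis
    using le[OF assms(2,1,3)] le[OF assms(1,2) orbit_sym[OF assms]] by simp
qed

lemma cayley_orbit_generator:
  assumes "m \<in> markoff_moves \<union> coordinate_permutations" "s \<in> cayley_solutions"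
  shows "cayley_orbit (m s) = cayley_orbit s"
  by (rule cayley_orbit_eqI[OF assms(2) generator_maps_solutions[OF assms] generator_in_orbit[OF assms]])

lemma cayley_orbit_refl:
  assumes "s \<in> cayley_solutions"
  shows "s \<in> cayley_orbit s"
  using group_action.orbit_refl[OF group_action_cayley_group assms] .

text \<open>Induction over the generated group. For the inverse of a generator, invariance under the
  generator is applied at the preimage point.\<close>

lemma cayley_orbit_invariant:
  assumes inv: "\<And>m s. m \<in> markoff_moves \<union> coordinate_permutations \<Longrightarrow> s \<in> cayley_solutions
      \<Longrightarrow> f (m s) = f s"
    and s: "s \<in> cayley_solutions" and s': "s' \<in> cayley_orbit s"
  shows "s' \<in> cayley_solutions \<and> f s' = f s"
proof -
  let ?S = "cayley_solutions :: ('a \<times> 'a \<times> 'a) set"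
  have *: "\<forall>x\<in>?S. h x \<in> ?S \<and> f (h x) = f x"
    if "h \<in> generate (BijGroup ?S) cayley_generators" for h
    using that
  proof (induction h rule: generate.induct)
    case one
    then show ?case by (simp add: BijGroup_def)
  next
    case (incl h)
    then obtain m where m: "m \<in> markoff_moves \<union> coordinate_permutations" "h = restrict m ?S"
      by (auto simp: cayley_generators_def)
    have "m x \<in> ?S \<and> f (m x) = f x" if "x \<in> ?S" for x
      using generator_maps_solutions[OF m(1) that] inv[OF m(1) that] by simp
    then show ?case using m(2) by simp
  next
    case (inv h)
    then obtain m where m: "m \<in> markoff_moves \<union> coordinate_permutations" "h = restrict m ?S"
      by (auto simp: cayley_generators_def)
    have h: "h \<in> Bij ?S" using inv cayley_generators_subset_Bij by blast
    show ?case
    proof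
      fix x assume x: "x \<in> ?S"
      have bij: "bij_betw h ?S ?S" using h by (simp add: Bij_def)
      let ?y = "inv_into ?S h x"
      have y: "?y \<in> ?S" "h ?y = x"
        using bij x by (auto simp: bij_betw_def inv_into_into f_inv_into_f)
      have "f x = f (m ?y)" using m y by simp
      also have "\<dots> = f ?y" by (rule assms(1)[OF m(1) y(1)])
      finally show "(inv\<^bsub>BijGroup ?S\<^esub> h) x \<in> ?S \<and> f ((inv\<^bsub>BijGroup ?S\<^esub> h) x) = f x"
        using x y by (simp add: inv_BijGroup[OF h])
    qed
  next
    case (eng h1 h2)
    have "h1 \<in> Bij ?S" "h2 \<in> Bij ?S"
      using eng.hyps subgroup.subset[OF subgroup_cayley_group] by (auto simp: BijGroup_def)
    then show ?case using eng.IH by (simp add: BijGroup_def compose_def)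
  qed
  obtain h where "h \<in> generate (BijGroup ?S) cayley_generators" "s' = h s"
    using s' by (auto simp: orbit_def cayley_group_def)
  then show ?thesis using * s by auto
qed

text \<open>The difference of the two sides times \<open>u * v\<close> factors as
  \<open>(u - v) * (u * v - 1)\<close>.\<close>

lemma add_inverse_eq_iff:
  fixes u v :: "'k :: field"
  assumes "u \<noteq> 0" "v \<noteq> 0"
  shows "u + inverse u = v + inverse v \<longleftrightarrow> u = v \<or> u * v = 1"
proof -
  have "(u - v) * (u * v - 1) = u * v * ((u + inverse u) - (v + inverse v))"
    using assms by (simp add: field_simps)
  then show ?thesis using assms by auto
qed

lemma CHAR_eq_CARD:
  assumes "prime CARD('a :: {field, finite})"
  shows "CHAR('a) = CARD('a)"
proof -
  have "CHAR('a) > 0" by (rule finite_imp_CHAR_pos) simp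
  then have "prime CHAR('a)" by (rule prime_CHAR_semidom)
  moreover have "CHAR('a) dvd CARD('a)" using CHAR_dvd_CARD[where 'a = 'a] by simp
  ultimately show ?thesis using assms by (simp add: primes_dvd_imp_eq)
qed

section \<open>Traces of powers of a primitive root of unity\<close>

locale cayley_parametrization =
  fixes p :: nat and g :: "'a :: {field, finite} alg_closure"
  assumes prime_p: "prime p" and p_ge: "p \<ge> 5" and card_a: "CARD('a) = p"
    and g_power_eq_1: "g ^ k = 1 \<longleftrightarrow> p\<^sup>2 - 1 dvd k"
begin

text \<open>An integer version of p^2 - 1, since exponents of \<open>g\<close> are allowed to be
  negative.\<close>

abbreviation N :: int where "N \<equiv> (int p)\<^sup>2 - 1"

lemma int_N: "int (p\<^sup>2 - 1) = N"
  using p_ge by (simp add: of_nat_diff)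

lemma N_factor: "N = (int p - 1) * (int p + 1)"
  by (simp add: power2_eq_square algebra_simps)

lemma N_pos: "N > 0"
  using p_ge unfolding N_factor by simp

lemma g_nonzero: "g \<noteq> 0"
proof
  assume "g = 0"
  moreover have "g ^ (p\<^sup>2 - 1) = 1" by (subst g_power_eq_1) (rule dvd_refl)
  moreover have "p\<^sup>2 - 1 \<noteq> 0" using int_N N_pos by linarith
  ultimately show False by (simp add: power_0_left)
qed

lemma g_powi_eq_1: "g powi k = 1 \<longleftrightarrow> N dvd k"
proof -
  have pos: "g powi k = 1 \<longleftrightarrow> N dvd k" if "k \<ge> 0" for k
  proof -
    have "g powi k = 1 \<longleftrightarrow> p\<^sup>2 - 1 dvd nat k"
      using that g_power_eq_1 by (simp add: power_int_nonneg_exp)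
    also have "\<dots> \<longleftrightarrow> int (p\<^sup>2 - 1) dvd int (nat k)" by (simp only: int_dvd_int_iff)
    finally show ?thesis using that by (simp only: int_N int_nat_eq if_True)
  qed
  show ?thesis
  proof (cases "k \<ge> 0")
    case False
    have "g powi k = 1 \<longleftrightarrow> g powi (- k) = 1" by (simp add: power_int_minus)
    also have "\<dots> \<longleftrightarrow> N dvd - k" using False by (intro pos) simp
    finally show ?thesis by simp
  qed (rule pos)
qed

lemma g_powi_eq_iff: "g powi a = g powi b \<longleftrightarrow> N dvd a - b"
proof -
  have "g powi (a - b) = g powi a / g powi b" using g_nonzero by (simp add: power_int_diff)
  then have "g powi (a - b) = 1 \<longleftrightarrow> g powi a = g powi b" using g_nonzero by simp
  then show ?thesis using g_powi_eq_1 by simp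
qed

text \<open>The trace of the diagonal matrix with entries \<open>g powi a\<close> and
  \<open>g powi (- a)\<close>; its product rule \<open>tr_mult\<close> is what makes the Markoff
  moves linear in the exponents.\<close>

definition tr :: "int \<Rightarrow> 'a alg_closure" where
  "tr a = g powi a + g powi (- a)"

lemma tr_minus [simp]: "tr (- a) = tr a"
  by (simp add: tr_def)

lemma tr_0 [simp]: "tr 0 = 2"
  by (simp add: tr_def)

lemma tr_mult: "tr a * tr b = tr (a + b) + tr (a - b)"
proof -
  have "g powi (x + y) = g powi x * g powi y" for x y
    using g_nonzero by (simp add: power_int_add)
  from this[of a b] this[of a "-b"] this[of "-a" b] this[of "-a" "-b"] show ?thesis
    by (simp add: tr_def algebra_simps)
qed

lemma tr_eq_iff: "tr a = tr b \<longleftrightarrow> N dvd a - b \<or> N dvd a + b"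
proof -
  define u where "u = g powi a"
  define v where "v = g powi b"
  have nz: "u \<noteq> 0" "v \<noteq> 0" using g_nonzero by (auto simp: u_def v_def)
  have "tr a = tr b \<longleftrightarrow> u + inverse u = v + inverse v"
    by (simp add: tr_def u_def v_def power_int_minus)
  also have "\<dots> \<longleftrightarrow> u = v \<or> u * v = 1" by (rule add_inverse_eq_iff[OF nz])
  also have "u * v = g powi (a + b)" using g_nonzero by (simp add: u_def v_def power_int_add)
  finally show ?thesis using g_powi_eq_1 g_powi_eq_iff by (simp add: u_def v_def)
qed

lemma CHAR_a: "CHAR('a) = p"
  using CHAR_eq_CARD[where 'a = 'a] prime_p card_a by simp

lemma frobenius_add: "(x + y :: 'a alg_closure) ^ p = x ^ p + y ^ p"
  by (rule freshmans_dream) (simp_all add: CHAR_a prime_p)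

lemma tr_frobenius: "tr a ^ p = tr (int p * a)"
  by (simp add: tr_def frobenius_add power_int_power' mult.commute)

text \<open>The \<open>p\<close> elements of the base field are roots of X^p - X, which has at most
  \<open>p\<close> roots in the closure.\<close>

lemma power_p_eq_self_iff: "x ^ p = x \<longleftrightarrow> x \<in> range (to_ac :: 'a \<Rightarrow> _)"
proof -
  let ?P = "monom 1 p - monom 1 1 :: 'a alg_closure poly"
  have "coeff ?P p = 1" using p_ge by (simp add: coeff_monom)
  then have P0: "?P \<noteq> 0" by (metis coeff_0 zero_neq_one)
  have eq: "{x. poly ?P x = 0} = {x. x ^ p = x}" by (simp add: poly_monom)
  have "degree ?P \<le> p"
    using p_ge by (intro degree_diff_le) (auto simp: degree_monom_eq)
  then have "card {x :: 'a alg_closure. x ^ p = x} \<le> p"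
    using card_poly_roots_bound[OF P0] eq by simp
  moreover have "finite {x :: 'a alg_closure. x ^ p = x}" using poly_roots_finite[OF P0] eq by simp
  moreover have "range (to_ac :: 'a \<Rightarrow> _) \<subseteq> {x. x ^ p = x}"
  proof clarify
    fix x :: 'a
    \<comment> \<open>The base field is a prime field, so each element is some
      \<open>of_nat k\<close>, and these are fixed by Frobenius by induction on
      \<open>k\<close>.\<close>
    have "inj_on (of_nat :: nat \<Rightarrow> 'a) {..<p}"
      by (intro inj_onI) (auto simp: of_nat_eq_iff_cong_CHAR CHAR_a cong_def)
    then have "card ((of_nat :: nat \<Rightarrow> 'a) ` {..<p}) = CARD('a)"
      by (simp add: card_image card_a)
    then have "(of_nat :: nat \<Rightarrow> 'a) ` {..<p} = UNIV" by (intro card_subset_eq) auto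
    then obtain k where "x = of_nat k" by auto
    moreover have "(of_nat k :: 'a alg_closure) ^ p = of_nat k"
      by (induction k) (use p_ge in \<open>simp_all add: frobenius_add power_0_left\<close>)
    ultimately show "to_ac x ^ p = to_ac x" by simp
  qed
  moreover have "card (range (to_ac :: 'a \<Rightarrow> _)) = p"
    using card_image[OF inj_to_ac] card_a by metis
  ultimately have "range (to_ac :: 'a \<Rightarrow> _) = {x. x ^ p = x}"
    by (metis card_seteq)
  then show ?thesis by auto
qed

text \<open>Frobenius multiplies the exponent by \<open>p\<close>, so the trace is fixed iff
  \<open>p * a\<close> is \<open>a\<close> or \<open>- a\<close> modulo \<open>N\<close>. Cancelling
  one factor of \<open>N = (p - 1) * (p + 1)\<close> leaves the stated condition.\<close>

lemma tr_in_range_iff: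
  "tr a \<in> range (to_ac :: 'a \<Rightarrow> _) \<longleftrightarrow> int p + 1 dvd a \<or> int p - 1 dvd a"
proof -
  have "tr a \<in> range (to_ac :: 'a \<Rightarrow> _) \<longleftrightarrow> tr (int p * a) = tr a"
    by (simp flip: power_p_eq_self_iff add: tr_frobenius)
  also have "\<dots> \<longleftrightarrow> N dvd (int p - 1) * a \<or> N dvd (int p + 1) * a"
    unfolding tr_eq_iff by (simp add: algebra_simps)
  also have "N dvd (int p - 1) * a \<longleftrightarrow> int p + 1 dvd a"
    unfolding N_factor using p_ge by simp
  also have "N dvd (int p + 1) * a \<longleftrightarrow> int p - 1 dvd a"
    unfolding N_factor mult.commute[of "int p - 1"] using p_ge by simp
  finally show ?thesis .
qed

section \<open>Parametrization of the solutions by pairs of exponents\<close>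

text \<open>Multiples of p + 1 are the exponents of (p-1)-th roots of unity, and multiples of p - 1
  those of (p+1)-th roots. One modulus must serve both exponents, so that all their integral
  combinations have traces in the base field.\<close>

definition rational :: "int \<Rightarrow> int \<Rightarrow> bool" where
  "rational a b \<longleftrightarrow> (\<exists>m\<in>{int p + 1, int p - 1}. m dvd a \<and> m dvd b)"

text \<open>Meaningful where \<open>tr a\<close> comes from the base field, which is the condition
  in \<open>to_ac_trace\<close>.\<close>

definition trace :: "int \<Rightarrow> 'a" where
  "trace a = of_ac (tr a)"

definition sol :: "int \<Rightarrow> int \<Rightarrow> 'a \<times> 'a \<times> 'a" where
  "sol a b = (trace a, trace b, trace (a + b))"

lemma trace_minus [simp]: "trace (- a) = trace a"
  by (simp add: trace_def)

lemma to_ac_trace: "int p + 1 dvd a \<or> int p - 1 dvd a \<Longrightarrow> to_ac (trace a) = tr a"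
  unfolding trace_def by (rule to_ac_of_ac) (simp only: tr_in_range_iff)

lemma rational_linear:
  assumes "rational a b"
  shows "rational (x * a + y * b) (z * a + w * b)"
  using assms unfolding rational_def by (meson dvd_add dvd_mult)

lemma rational_dvd:
  assumes "rational a b"
  shows "int p + 1 dvd x * a + y * b \<or> int p - 1 dvd x * a + y * b"
  using assms unfolding rational_def by (metis dvd_add dvd_mult insertE singletonD)

lemma to_ac_trace_rational:
  assumes "rational a b"
  shows "to_ac (trace a) = tr a" "to_ac (trace b) = tr b"
    "to_ac (trace (a + b)) = tr (a + b)" "to_ac (trace (a - b)) = tr (a - b)"
  using rational_dvd[OF assms, of 1 0] rational_dvd[OF assms, of 0 1] rational_dvd[OF assms, of 1 1]
    rational_dvd[OF assms, of 1 "-1"]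
  by (simp_all add: to_ac_trace)

lemma trace_mult:
  assumes "rational a b"
  shows "trace a * trace b = trace (a + b) + trace (a - b)"
proof -
  have "to_ac (trace a * trace b) = to_ac (trace (a + b) + trace (a - b))"
    by (simp only: to_ac_mult to_ac_add to_ac_trace_rational[OF assms] tr_mult)
  then show ?thesis by (simp only: to_ac_eq_iff)
qed

lemma tr_square: "tr a ^ 2 = tr (2 * a) + 2"
  using tr_mult[of a a] by (simp add: power2_eq_square)

text \<open>For fixed first two coordinates the cubic is quadratic in \<open>z\<close>. Its roots
  \<open>tr (a + b)\<close> and \<open>tr (a - b)\<close>, exchanged by the Vieta move, have sum
  \<open>tr a * tr b\<close> and product \<open>tr a ^ 2 + tr b ^ 2 - 4\<close>.\<close>

lemma tr_factor:
  "(z - tr (a + b)) * (z - tr (a - b)) = tr a ^ 2 + tr b ^ 2 + z ^ 2 - (tr a * tr b * z + 4)"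
proof -
  have "tr (a + b) * tr (a - b) = tr a ^ 2 + tr b ^ 2 - 4"
    using tr_mult[of "a + b" "a - b"] tr_square[of a] tr_square[of b] by (simp add: algebra_simps)
  moreover have "(z - tr (a + b)) * (z - tr (a - b)) =
      z ^ 2 - (tr (a + b) + tr (a - b)) * z + tr (a + b) * tr (a - b)"
    by (simp add: algebra_simps power2_eq_square)
  ultimately show ?thesis by (simp add: tr_mult[symmetric])
qed

lemma sol_in_solutions:
  assumes "rational a b"
  shows "sol a b \<in> cayley_solutions"
proof -
  have "to_ac ((trace a)\<^sup>2 + (trace b)\<^sup>2 + (trace (a + b))\<^sup>2) =
        to_ac (trace a * trace b * trace (a + b) + 4)"
    using tr_factor[of "tr (a + b)" a b]
    by (simp only: to_ac_mult to_ac_add to_ac_power to_ac_numeral to_ac_trace_rational[OF assms]) simp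
  then show ?thesis by (simp only: to_ac_eq_iff) (simp add: sol_def cayley_solutions_def)
qed

text \<open>Write the element as u + 1/u in the closure. Frobenius fixes it, so u^p is u or 1/u,
  which makes u a (p-1)-th or (p+1)-th root of unity and hence a power of \<open>g\<close>.\<close>

lemma ex_tr_eq: "\<exists>a. to_ac (x :: 'a) = tr a"
proof -
  define X' where "X' = to_ac x"
  \<comment> \<open>The coefficients are those of \<open>1 - X' * u + u ^ 2\<close>, whose roots
    satisfy \<open>u + inverse u = X'\<close>.\<close>
  have "\<exists>u. (\<Sum>k\<le>2. (if k = 1 then - X' else 1) * u ^ k) = 0"
    by (rule alg_closed) auto
  then obtain u where u: "1 - X' * u + u ^ 2 = 0"
    by (auto simp: numeral_2_eq_2)
  have u0: "u \<noteq> 0" using u by auto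
  have X': "X' = u + inverse u"
  proof -
    have "X' * u = 1 + u * u" using u by (simp add: power2_eq_square algebra_simps)
    then have "X' * u * inverse u = (1 + u * u) * inverse u" by simp
    then show ?thesis using u0 by (simp add: algebra_simps)
  qed
  have "X' ^ p = X'" using power_p_eq_self_iff[of X'] by (simp add: X'_def)
  then have eq: "u ^ p + inverse (u ^ p) = u + inverse u"
    unfolding X' frobenius_add by (simp add: power_inverse)
  define v where "v = u ^ p"
  have v0: "v \<noteq> 0" using u0 by (simp add: v_def)
  have "v = u \<or> v * u = 1" using eq add_inverse_eq_iff[OF v0 u0] by (simp add: v_def)
  then have "u ^ (p\<^sup>2 - 1) = 1"
  proof
    assume "v = u"
    moreover have "v = u ^ (p - 1) * u" using p_ge by (simp add: v_def flip: power_Suc2)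
    ultimately have "u ^ (p - 1) = 1" using u0 by simp
    moreover have "p\<^sup>2 - 1 = (p - 1) * (p + 1)" by (simp add: power2_eq_square algebra_simps)
    ultimately show ?thesis by (simp only: power_mult power_one)
  next
    assume "v * u = 1"
    then have "u ^ (p + 1) = 1" by (simp add: v_def mult.commute)
    moreover have "p\<^sup>2 - 1 = (p + 1) * (p - 1)" by (simp add: power2_eq_square algebra_simps)
    ultimately show ?thesis by (simp only: power_mult power_one)
  qed
  moreover have "p\<^sup>2 - 1 > 0" using int_N N_pos by linarith
  ultimately obtain k where "u = g ^ k" using root_of_unity_eq_power[of g "p\<^sup>2 - 1" u] g_power_eq_1 by blast
  then have "X' = tr (int k)" unfolding X' by (simp add: tr_def power_int_minus)
  then show ?thesis unfolding X'_def by blast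
qed

text \<open>If \<open>a\<close> and \<open>b\<close> were multiples of different moduli, the modulus
  dividing \<open>a + b\<close> would divide one of them and therefore also the other.\<close>

lemma rationalI:
  assumes "tr a \<in> range (to_ac :: 'a \<Rightarrow> _)" "tr b \<in> range (to_ac :: 'a \<Rightarrow> _)"
    "tr (a + b) \<in> range (to_ac :: 'a \<Rightarrow> _)"
  shows "rational a b"
  using assms unfolding tr_in_range_iff rational_def
  by (metis dvd_add_left_iff dvd_add_right_iff insertI1 insertI2)

text \<open>Exponents of the first two coordinates are chosen separately. The third is then one of
  the two roots in \<open>tr_factor\<close>, and changing the sign of \<open>b\<close> turns
  \<open>a - b\<close> into a sum without altering the second coordinate.\<close>

lemma ex_sol:
  assumes "s \<in> cayley_solutions"
  shows "\<exists>a b. rational a b \<and> s = sol a b"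
proof -
  obtain x y z where s: "s = (x, y, z)" by (cases s)
  have eq: "x\<^sup>2 + y\<^sup>2 + z\<^sup>2 = x * y * z + 4" using assms by (simp add: s cayley_solutions_def)
  obtain a where a: "to_ac x = tr a" using ex_tr_eq by blast
  obtain b where b: "to_ac y = tr b" using ex_tr_eq by blast
  have "to_ac (x\<^sup>2 + y\<^sup>2 + z\<^sup>2) = to_ac (x * y * z + 4)" by (simp only: eq)
  then have "tr a ^ 2 + tr b ^ 2 + to_ac z ^ 2 = tr a * tr b * to_ac z + 4"
    by (simp add: a b)
  then have "(to_ac z - tr (a + b)) * (to_ac z - tr (a - b)) = 0"
    unfolding tr_factor by simp
  then have "to_ac z = tr (a + b) \<or> to_ac z = tr (a + (- b))" by auto
  then obtain b' where b': "to_ac y = tr b'" "to_ac z = tr (a + b')"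
    using b tr_minus by metis
  have "rational a b'" by (rule rationalI) (metis a b' rangeI)+
  moreover have "s = sol a b'"
    unfolding s sol_def trace_def a[symmetric] b'[symmetric] by simp
  ultimately show ?thesis by blast
qed

text \<open>Each trace fixes its exponent up to sign modulo \<open>N\<close>. If the signs at
  \<open>a\<close> and \<open>b\<close> differ, the third trace transfers one of them, so a common
  sign can always be chosen.\<close>

lemma sol_eq_iff:
  assumes "rational a b" "rational a' b'"
  shows "sol a b = sol a' b' \<longleftrightarrow> (N dvd a - a' \<and> N dvd b - b') \<or> (N dvd a + a' \<and> N dvd b + b')"
proof -
  have "sol a b = sol a' b' \<longleftrightarrow> tr a = tr a' \<and> tr b = tr b' \<and> tr (a + b) = tr (a' + b')"
    unfolding sol_def prod.inject to_ac_eq_iff[symmetric, of "trace _"]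
    by (simp only: to_ac_trace_rational[OF assms(1)] to_ac_trace_rational[OF assms(2)])
  also have "\<dots> \<longleftrightarrow> (N dvd a - a' \<and> N dvd b - b') \<or> (N dvd a + a' \<and> N dvd b + b')"
    (is "?L \<longleftrightarrow> ?R")
  proof
    have eqs: "a + b - (a' + b') = (a - a') + (b - b')" "a + b + (a' + b') = (a + a') + (b + b')"
      by simp_all
    show "?L \<Longrightarrow> ?R" unfolding tr_eq_iff eqs
      by (metis dvd_add_left_iff dvd_add_right_iff)
    show "?R \<Longrightarrow> ?L" unfolding tr_eq_iff eqs by (metis dvd_add)
  qed
  finally show ?thesis .
qed

lemma rational_N: "rational a 0 \<Longrightarrow> rational a N"
  unfolding rational_def N_factor by auto

section \<open>The action on exponents and its gcd invariant\<close>

text \<open>Each generator acts on the exponents by an integral matrix with integral inverse, which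
  preserves common divisors. For permutations the signs are chosen so that the third exponent is
  again the sum of the other two.\<close>

lemma generator_sol:
  assumes m: "m \<in> markoff_moves \<union> coordinate_permutations" and ab: "rational a b"
  shows "\<exists>a' b'. rational a' b' \<and> m (sol a b) = sol a' b' \<and> gcd (gcd a' b') N = gcd (gcd a b) N"
proof -
  have g1: "rational b (a + b)" "rational a (a + b)"
    using rational_linear[OF ab, of 0 1 1 1] rational_linear[OF ab, of 1 0 1 1] by simp_all
  have moves: "trace b * trace (a + b) - trace a = trace (a + 2 * b)"
    "trace a * trace (a + b) - trace b = trace (2 * a + b)"
    "trace a * trace b - trace (a + b) = trace (a - b)"
    using trace_mult[OF g1(1)] trace_mult[OF g1(2)] trace_mult[OF ab] trace_minus[of a] trace_minus[of b]
    by (simp_all add: algebra_simps)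
  \<comment> \<open>The matrix has rows \<open>x y\<close> and \<open>z w\<close>; the primed
    entries are those of its inverse. In the instantiations below the eight numbers come in this
    order.\<close>
  have lin: "\<exists>a' b'. rational a' b' \<and> m (sol a b) = sol a' b' \<and> gcd (gcd a' b') N = gcd (gcd a b) N"
    if eq: "m (sol a b) = sol (x * a + y * b) (z * a + w * b)"
      and inv: "x' * (x * a + y * b) + y' * (z * a + w * b) = a"
        "z' * (x * a + y * b) + w' * (z * a + w * b) = b" for x y z w x' y' z' w'
  proof (intro exI conjI)
    show "rational (x * a + y * b) (z * a + w * b)" by (rule rational_linear[OF ab])
    show "gcd (gcd (x * a + y * b) (z * a + w * b)) N = gcd (gcd a b) N"
    proof (rule gcd_gcd_eqI)
      fix c :: int
      show "c dvd x * a + y * b \<and> c dvd z * a + w * b \<longleftrightarrow> c dvd a \<and> c dvd b"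
        using inv by (metis dvd_add dvd_mult)
    qed
  qed (rule eq)
  from m consider
      "m = (\<lambda>(x, y, z). (y * z - x, y, z))" | "m = (\<lambda>(x, y, z). (x, x * z - y, z))"
    | "m = (\<lambda>(x, y, z). (x, y, x * y - z))" | "m = (\<lambda>(x, y, z). (x, y, z))"
    | "m = (\<lambda>(x, y, z). (x, z, y))" | "m = (\<lambda>(x, y, z). (y, x, z))"
    | "m = (\<lambda>(x, y, z). (y, z, x))" | "m = (\<lambda>(x, y, z). (z, x, y))"
    | "m = (\<lambda>(x, y, z). (z, y, x))"
    unfolding markoff_moves_def coordinate_permutations_def by blast
  then show ?thesis
  proof cases
    case 1 show ?thesis
      by (rule lin[of 1 2 0 "-1" 1 2 0 "-1"]) (simp_all add: 1 sol_def moves add.commute[of b a])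
  next
    case 2 show ?thesis
      by (rule lin[of "-1" 0 2 1 "-1" 0 2 1]) (simp_all add: 2 sol_def moves)
  next
    case 3 show ?thesis
      by (rule lin[of 1 0 0 "-1" 1 0 0 "-1"]) (simp_all add: 3 sol_def moves)
  next
    case 4 show ?thesis
      by (rule lin[of 1 0 0 1 1 0 0 1]) (simp_all add: 4 sol_def)
  next
    case 5 show ?thesis
      by (rule lin[of "-1" 0 1 1 "-1" 0 1 1]) (simp_all add: 5 sol_def)
  next
    case 6 show ?thesis
      by (rule lin[of 0 1 1 0 0 1 1 0]) (simp_all add: 6 sol_def add.commute)
  next
    case 7 show ?thesis
      by (rule lin[of 0 "-1" 1 1 1 1 "-1" 0]) (simp_all add: 7 sol_def)
  next
    case 8 show ?thesis
      by (rule lin[of 1 1 "-1" 0 0 "-1" 1 1]) (simp_all add: 8 sol_def)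
  next
    case 9 show ?thesis
      by (rule lin[of 1 1 0 "-1" 1 1 0 "-1"]) (simp_all add: 9 sol_def)
  qed
qed

text \<open>A definite description, because a solution has several exponent pairs;
  \<open>sol_index_sol\<close> shows that they all yield the same value.\<close>

definition sol_index :: "'a \<times> 'a \<times> 'a \<Rightarrow> int" where
  "sol_index s = (THE t. \<exists>a b. rational a b \<and> s = sol a b \<and> t = gcd (gcd a b) N)"

text \<open>By \<open>sol_eq_iff\<close>, two exponent pairs of one solution agree modulo
  \<open>N\<close> up to a common sign, so they have the same common divisors with
  \<open>N\<close>.\<close>

lemma sol_index_sol:
  assumes "rational a b"
  shows "sol_index (sol a b) = gcd (gcd a b) N"
  unfolding sol_index_def
proof (rule the_equality)
  show "\<exists>a' b'. rational a' b' \<and> sol a b = sol a' b' \<and> gcd (gcd a b) N = gcd (gcd a' b') N"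
    using assms by blast
next
  fix t assume "\<exists>a' b'. rational a' b' \<and> sol a b = sol a' b' \<and> t = gcd (gcd a' b') N"
  then obtain a' b' where *: "rational a' b'" "sol a b = sol a' b'" and t: "t = gcd (gcd a' b') N"
    by blast
  have "(N dvd a - a' \<and> N dvd b - b') \<or> (N dvd a + a' \<and> N dvd b + b')"
    using sol_eq_iff[OF assms *(1)] *(2) by simp
  then have "gcd (gcd a' b') N = gcd (gcd a b) N"
  proof (intro gcd_gcd_eqI)
    fix x assume x: "x dvd N"
    have diff: "x dvd u \<longleftrightarrow> x dvd v" if "N dvd v - u" for u v
      using dvd_trans[OF x that] by (metis dvd_diff_commute dvd_diff_left_iff dvd_diff_right_iff)
    have sum: "x dvd u \<longleftrightarrow> x dvd v" if "N dvd v + u" for u v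
      using dvd_trans[OF x that] by (metis dvd_add_left_iff dvd_add_right_iff)
    assume "(N dvd a - a' \<and> N dvd b - b') \<or> (N dvd a + a' \<and> N dvd b + b')"
    then show "x dvd a' \<and> x dvd b' \<longleftrightarrow> x dvd a \<and> x dvd b"
      using diff[of a a'] diff[of b b'] sum[of a a'] sum[of b b'] by argo
  qed
  then show "t = gcd (gcd a b) N" using t by simp
qed

lemma sol_index_generator:
  assumes "m \<in> markoff_moves \<union> coordinate_permutations" "s \<in> cayley_solutions"
  shows "sol_index (m s) = sol_index s"
proof -
  obtain a b where ab: "rational a b" "s = sol a b" using ex_sol[OF assms(2)] by blast
  obtain a' b' where "rational a' b'" "m s = sol a' b'" "gcd (gcd a' b') N = gcd (gcd a b) N"
    using generator_sol[OF assms(1) ab(1)] ab(2) by blast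
  then show ?thesis using sol_index_sol ab by metis
qed

lemma sol_index_orbit:
  assumes "rational a b" "s \<in> cayley_orbit (sol a b)"
  shows "s \<in> cayley_solutions" "sol_index s = gcd (gcd a b) N"
proof -
  have "s \<in> cayley_solutions \<and> sol_index s = sol_index (sol a b)"
    by (rule cayley_orbit_invariant[OF _ sol_in_solutions[OF assms(1)] assms(2)])
       (rule sol_index_generator)
  then show "s \<in> cayley_solutions" "sol_index s = gcd (gcd a b) N"
    using sol_index_sol[OF assms(1)] by simp_all
qed

section \<open>The Euclidean algorithm inside an orbit\<close>

lemma orbit_sol_swap: "rational a b \<Longrightarrow> cayley_orbit (sol b a) = cayley_orbit (sol a b)"
  using cayley_orbit_generator[of "\<lambda>(x, y, z). (y, x, z)" "sol a b"] sol_in_solutions[of a b]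
  by (simp add: coordinate_permutations_def sol_def add.commute)

text \<open>The third Markoff move replaces \<open>trace (a + b)\<close> by
  \<open>trace (a - b)\<close>, which is a sign change of \<open>b\<close>.\<close>

lemma orbit_sol_minus: "rational a b \<Longrightarrow> cayley_orbit (sol a (- b)) = cayley_orbit (sol a b)"
  using cayley_orbit_generator[of "\<lambda>(x, y, z). (x, y, x * y - z)" "sol a b"]
    sol_in_solutions[of a b] trace_mult[of a b]
  by (simp add: markoff_moves_def sol_def)

lemma rational_swap: "rational a b \<Longrightarrow> rational b a"
  using rational_linear[of a b 0 1 1 0] by simp

text \<open>Exchanging the last two coordinates sends the exponents to \<open>- a\<close> and
  \<open>a + b\<close>; swaps and a sign change then bring them to \<open>a\<close> and
  \<open>a + b\<close>.\<close>

lemma orbit_sol_add: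
  assumes "rational a b" shows "cayley_orbit (sol a (b + a)) = cayley_orbit (sol a b)"
proof -
  have "rational (a + b) (- a)" using rational_linear[OF assms, of 1 1 "-1" 0] by simp
  have "cayley_orbit (sol (- a) (a + b)) = cayley_orbit (sol a b)"
    using cayley_orbit_generator[of "\<lambda>(x, y, z). (x, z, y)" "sol a b"] sol_in_solutions[OF assms]
    by (simp add: coordinate_permutations_def sol_def)
  also have "cayley_orbit (sol (- a) (a + b)) = cayley_orbit (sol (a + b) (- a))"
    by (rule orbit_sol_swap) fact
  also have "\<dots> = cayley_orbit (sol (a + b) a)"
    using rational_linear[OF assms, of 1 1 1 0] by (intro orbit_sol_minus) simp
  also have "\<dots> = cayley_orbit (sol a (a + b))"
    using rational_linear[OF assms, of 1 0 1 1] by (intro orbit_sol_swap) simp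
  finally show ?thesis by (simp add: add.commute)
qed

lemma orbit_sol_add_mult:
  assumes "rational a b"
  shows "cayley_orbit (sol a (b + int k * a)) = cayley_orbit (sol a b)"
proof (induction k)
  case (Suc k)
  have "rational a (b + int k * a)" using rational_linear[OF assms, of 1 0 "int k" 1] by (simp add: add.commute)
  from orbit_sol_add[OF this] Suc show ?case by (simp add: algebra_simps)
qed simp

text \<open>One Euclidean step is a swap followed by removing \<open>m div n\<close> copies of
  \<open>n\<close>, both of which stay in the orbit.\<close>

lemma orbit_sol_gcd_nat:
  "rational (int m) (int n) \<Longrightarrow> cayley_orbit (sol (int m) (int n)) = cayley_orbit (sol (int (gcd m n)) 0)"
proof (induction m n rule: gcd_nat_induct)
  case (step m n)
  have eq: "int m = int (m mod n) + int (m div n) * int n"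
    by (metis mod_mult_div_eq mult.commute of_nat_add of_nat_mult)
  have rational: "rational (int n) (int (m mod n))"
    using rational_linear[OF step.prems, of 0 1 1 "- int (m div n)"] eq by simp
  have "cayley_orbit (sol (int m) (int n)) = cayley_orbit (sol (int n) (int m))"
    by (rule orbit_sol_swap[OF rational_swap[OF step.prems]])
  also have "\<dots> = cayley_orbit (sol (int n) (int (m mod n)))"
    by (subst eq) (rule orbit_sol_add_mult[OF rational])
  also have "\<dots> = cayley_orbit (sol (int (gcd n (m mod n))) 0)" by (rule step.IH[OF rational])
  also have "gcd n (m mod n) = gcd m n" by (metis gcd_red_nat)
  finally show ?case .
qed simp

text \<open>Both signs are removed by \<open>orbit_sol_minus\<close>, with a swap in between, which
  reduces the claim to natural exponents.\<close>

lemma orbit_sol_gcd: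
  assumes "rational a b"
  shows "cayley_orbit (sol a b) = cayley_orbit (sol (gcd a b) 0)"
proof -
  have right: "cayley_orbit (sol x \<bar>y\<bar>) = cayley_orbit (sol x y)" if "rational x y" for x y
    using orbit_sol_minus[OF that] by (simp add: abs_if)
  have g: "rational a \<bar>b\<bar>" "rational \<bar>b\<bar> a" using assms rational_swap[OF assms] by (simp_all add: rational_def)
  have "cayley_orbit (sol a b) = cayley_orbit (sol a \<bar>b\<bar>)" using right[OF assms] by simp
  also have "\<dots> = cayley_orbit (sol \<bar>b\<bar> a)" using orbit_sol_swap[OF g(1)] by simp
  also have "\<dots> = cayley_orbit (sol \<bar>b\<bar> \<bar>a\<bar>)" using right[OF g(2)] by simp
  also have "\<dots> = cayley_orbit (sol (int (nat \<bar>b\<bar>)) (int (nat \<bar>a\<bar>)))" by simp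
  also have "\<dots> = cayley_orbit (sol (int (gcd (nat \<bar>b\<bar>) (nat \<bar>a\<bar>))) 0)"
    using assms by (intro orbit_sol_gcd_nat) (auto simp: rational_def)
  also have "int (gcd (nat \<bar>b\<bar>) (nat \<bar>a\<bar>)) = gcd a b"
    unfolding gcd_int_int_eq[symmetric] by (simp add: gcd.commute)
  finally show ?thesis .
qed

text \<open>Once the second exponent is 0, it may be replaced by \<open>N\<close> without changing
  the solution; a second run of the Euclidean algorithm brings \<open>N\<close> into the
  gcd.\<close>

lemma orbit_sol_eq:
  assumes "rational a b"
  shows "cayley_orbit (sol a b) = cayley_orbit (sol (gcd (gcd a b) N) 0)"
proof -
  have g0: "rational (gcd a b) 0" using assms unfolding rational_def by (metis dvd_0_right gcd_greatest)
  have "cayley_orbit (sol a b) = cayley_orbit (sol (gcd a b) 0)" by (rule orbit_sol_gcd[OF assms])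
  also have "sol (gcd a b) 0 = sol (gcd a b) N"
    by (subst sol_eq_iff[OF g0 rational_N[OF g0]]) (simp only: diff_self diff_0 dvd_minus_iff dvd_refl dvd_0_right simp_thms)
  also have "cayley_orbit \<dots> = cayley_orbit (sol (gcd (gcd a b) N) 0)"
    by (rule orbit_sol_gcd[OF rational_N[OF g0]])
  finally show ?thesis .
qed

section \<open>Classification of the orbits by their index\<close>

lemma D_set_iff:
  "t \<in> D_set p \<longleftrightarrow> int t dvd N \<and> rational (int t) 0"
proof -
  have "t dvd p\<^sup>2 - 1 \<longleftrightarrow> int t dvd N" by (simp only: int_N[symmetric] int_dvd_int_iff)
  moreover have "p + 1 dvd t \<longleftrightarrow> int p + 1 dvd int t"
    using int_dvd_int_iff[of "p + 1" t] by (simp add: add.commute)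
  moreover have "p - 1 dvd t \<longleftrightarrow> int p - 1 dvd int t"
    using int_dvd_int_iff[of "p - 1" t] p_ge by (simp add: of_nat_diff)
  ultimately show ?thesis by (simp add: D_set_def rational_def)
qed

text \<open>The index is constant on the orbit, and conversely \<open>orbit_sol_eq\<close> moves
  every solution of index \<open>t\<close> to \<open>sol t 0\<close>.\<close>

lemma orbit_D_set:
  assumes "t \<in> D_set p"
  shows "cayley_orbit (sol (int t) 0) = {sol a b | a b. rational a b \<and> gcd (gcd a b) N = int t}"
proof (intro equalityI subsetI)
  have t: "rational (int t) 0" "int t dvd N" using assms by (auto simp: D_set_iff)
  have gt: "gcd (gcd (int t) 0) N = int t" using t(2) by simp
  {
    fix s assume "s \<in> cayley_orbit (sol (int t) 0)"
    from sol_index_orbit[OF t(1) this] have s: "s \<in> cayley_solutions" "sol_index s = int t"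
      unfolding gt by simp_all
    obtain a b where ab: "rational a b" "s = sol a b" using ex_sol[OF s(1)] by blast
    then have "gcd (gcd a b) N = int t" using sol_index_sol[OF ab(1)] s(2) by simp
    then show "s \<in> {sol a b | a b. rational a b \<and> gcd (gcd a b) N = int t}" using ab by blast
  next
    fix s assume "s \<in> {sol a b | a b. rational a b \<and> gcd (gcd a b) N = int t}"
    then obtain a b where ab: "rational a b" "gcd (gcd a b) N = int t" "s = sol a b" by blast
    have "s \<in> cayley_orbit (sol a b)"
      unfolding ab(3) by (rule cayley_orbit_refl[OF sol_in_solutions[OF ab(1)]])
    then show "s \<in> cayley_orbit (sol (int t) 0)"
      unfolding orbit_sol_eq[OF ab(1)] ab(2) .
  }
qed

text \<open>The index recovers \<open>t\<close> from its orbit, and \<open>orbit_sol_eq\<close>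
  shows that every orbit arises.\<close>

lemma bij_betw_D_set_orbits:
  "bij_betw (\<lambda>t. cayley_orbit (sol (int t) 0)) (D_set p) cayley_orbits"
  unfolding bij_betw_def
proof (intro conjI equalityI subsetI inj_onI)
  fix t t' assume t: "t \<in> D_set p" "t' \<in> D_set p"
    and eq: "cayley_orbit (sol (int t) 0) = cayley_orbit (sol (int t') 0)"
  have "rational (int t) 0" "rational (int t') 0" "gcd (int t) N = int t" "gcd (int t') N = int t'"
    using t by (simp_all add: D_set_iff)
  moreover have "sol (int t) 0 \<in> cayley_orbit (sol (int t') 0)"
    using eq cayley_orbit_refl[OF sol_in_solutions[OF \<open>rational (int t) 0\<close>]] by simp
  ultimately show "t = t'"
    using sol_index_orbit(2)[of "int t'" 0 "sol (int t) 0"] sol_index_sol[of "int t" 0] by simp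
next
  fix S assume "S \<in> (\<lambda>t. cayley_orbit (sol (int t) 0)) ` D_set p"
  then obtain t where "rational (int t) 0" "S = cayley_orbit (sol (int t) 0)"
    by (auto simp: D_set_iff)
  then show "S \<in> cayley_orbits"
    unfolding cayley_orbits_def orbits_def using sol_in_solutions by blast
next
  fix S assume "S \<in> (cayley_orbits :: ('a \<times> 'a \<times> 'a) set set)"
  then obtain s where "s \<in> cayley_solutions" and S: "S = cayley_orbit s"
    unfolding cayley_orbits_def orbits_def by blast
  then obtain a b where ab: "rational a b" "s = sol a b" using ex_sol by blast
  define t where "t = nat (gcd (gcd a b) N)"
  have t: "int t = gcd (gcd a b) N" by (simp add: t_def)
  \<comment> \<open>Both moduli divide \<open>N\<close>, so the one shared by \<open>a\<close> and
    \<open>b\<close> also divides their gcd with \<open>N\<close>.\<close>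
  have "int p + 1 dvd N" "int p - 1 dvd N" by (simp_all add: N_factor)
  then have "rational (int t) 0"
    using ab(1) unfolding t rational_def by (metis dvd_0_right gcd_greatest insertE singletonD)
  moreover have "int t dvd N" by (simp add: t)
  ultimately have "t \<in> D_set p" by (simp add: D_set_iff)
  moreover have "S = cayley_orbit (sol (int t) 0)"
    unfolding S ab(2) t by (rule orbit_sol_eq[OF ab(1)])
  ultimately show "S \<in> (\<lambda>t. cayley_orbit (sol (int t) 0)) ` D_set p" by blast
qed

section \<open>Orbit sizes\<close>

text \<open>One representative for each residue class modulo \<open>N\<close>, so that the exponent
  pairs over an orbit form a finite set.\<close>

definition index_pairs :: "nat \<Rightarrow> (int \<times> int) set" where
  "index_pairs t = {(a, b). 0 \<le> a \<and> a < N \<and> 0 \<le> b \<and> b < N \<and> gcd (gcd a b) N = int t}"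

lemma D_set_pos: "t \<in> D_set p \<Longrightarrow> t > 0"
  using N_pos by (cases "t = 0") (auto simp: D_set_iff)

text \<open>Dividing both exponents by \<open>t\<close> turns index \<open>t\<close> modulo
  \<open>N\<close> into primitivity modulo the cofactor of \<open>t\<close>.\<close>

lemma card_index_pairs:
  assumes "t \<in> D_set p"
  shows "real (card (index_pairs t)) = jordan_totient ((p\<^sup>2 - 1) div t)"
    and "finite (index_pairs t)"
proof -
  have t: "t > 0" by (rule D_set_pos[OF assms])
  obtain d where d: "p\<^sup>2 - 1 = t * d" using assms by (auto simp: D_set_def)
  have N: "N = int t * int d" using d int_N by (metis of_nat_mult)
  have d0: "d > 0" using N N_pos t by (cases d) auto
  let ?f = "\<lambda>(a, b). (int t * int a, int t * int b)"
  have "bij_betw ?f (primitive_pairs d) (index_pairs t)"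
    unfolding bij_betw_def
  proof
    show "inj_on ?f (primitive_pairs d)" using t by (auto simp: inj_on_def)
    have g: "gcd (gcd (int t * a) (int t * b)) N = int t * gcd (gcd a b) (int d)" for a b
      by (simp add: N gcd_mult_left)
    have P_iff: "(a, b) \<in> primitive_pairs d \<longleftrightarrow> a < d \<and> b < d \<and> gcd (gcd (int a) (int b)) (int d) = 1" for a b
      unfolding primitive_pairs_def gcd_int_int_eq of_nat_eq_1_iff by simp
    have I_iff: "(a, b) \<in> index_pairs t \<longleftrightarrow> 0 \<le> a \<and> a < N \<and> 0 \<le> b \<and> b < N \<and> gcd (gcd a b) N = int t" for a b
      unfolding index_pairs_def by simp
    show "?f ` primitive_pairs d = index_pairs t"
    proof (intro equalityI subsetI)
      fix x assume "x \<in> ?f ` primitive_pairs d"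
      then obtain a b where ab: "(a, b) \<in> primitive_pairs d" and x: "x = (int t * int a, int t * int b)" by auto
      have "int t * int a < N" "int t * int b < N" using ab t unfolding P_iff N by simp_all
      then show "x \<in> index_pairs t" using ab unfolding x I_iff g P_iff by simp
    next
      fix x assume xI: "x \<in> index_pairs t"
      obtain a b where x: "x = (a, b)" by force
      note ab = xI[unfolded x I_iff]
      have "int t dvd a" "int t dvd b"
        using ab by (metis dvd_trans gcd_dvd1 gcd_dvd2)+
      then obtain a' b' where eq: "a = int t * a'" "b = int t * b'" unfolding dvd_def by auto
      have "0 \<le> a'" "0 \<le> b'" using ab t unfolding eq by (simp_all add: zero_le_mult_iff)
      moreover have "a' < int d" "b' < int d" using ab t unfolding eq N by simp_all
      moreover have "gcd (gcd a' b') (int d) = 1" using ab t unfolding eq g by simp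
      ultimately have "(nat a', nat b') \<in> primitive_pairs d" unfolding P_iff by auto
      moreover have "x = ?f (nat a', nat b')" using \<open>0 \<le> a'\<close> \<open>0 \<le> b'\<close> by (simp add: x eq)
      ultimately show "x \<in> ?f ` primitive_pairs d" by blast
    qed
  qed
  then have "card (primitive_pairs d) = card (index_pairs t)" "finite (index_pairs t)"
    using bij_betw_same_card bij_betw_finite finite_primitive_pairs by blast+
  moreover have "(p\<^sup>2 - 1) div t = d" using d t by simp
  ultimately show "real (card (index_pairs t)) = jordan_totient ((p\<^sup>2 - 1) div t)" "finite (index_pairs t)"
    using card_primitive_pairs[OF d0] by simp_all
qed

lemma rational_index_pairs:
  assumes "t \<in> D_set p" "int t dvd a" "int t dvd b"
  shows "rational a b"
  using assms unfolding D_set_iff rational_def by (metis dvd_trans)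

lemma index_pairs_rational:
  assumes "t \<in> D_set p" "gcd (gcd a b) N = int t"
  shows "rational a b"
  by (rule rational_index_pairs[OF assms(1)]; metis assms(2) dvd_trans gcd_dvd1 gcd_dvd2)

text \<open>Reducing exponents modulo \<open>N\<close> changes neither the solution nor its
  index.\<close>

lemma orbit_eq_image:
  assumes t: "t \<in> D_set p"
  shows "cayley_orbit (sol (int t) 0) = (\<lambda>(a, b). sol a b) ` index_pairs t"
  unfolding orbit_D_set[OF t]
proof (intro equalityI subsetI)
  fix s assume "s \<in> {sol a b | a b. rational a b \<and> gcd (gcd a b) N = int t}"
  then obtain a b where ab: "rational a b" "gcd (gcd a b) N = int t" "s = sol a b" by blast
  have g: "gcd (gcd (a mod N) (b mod N)) N = int t"
    unfolding ab(2)[symmetric] by (rule gcd_gcd_eqI) (simp add: dvd_mod_iff)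
  have "(a mod N, b mod N) \<in> index_pairs t"
    unfolding index_pairs_def using g N_pos by simp
  moreover have "s = sol (a mod N) (b mod N)"
    unfolding ab(3) by (subst sol_eq_iff[OF ab(1) index_pairs_rational[OF t g]]) (simp add: mod_eq_dvd_iff[symmetric])
  ultimately show "s \<in> (\<lambda>(a, b). sol a b) ` index_pairs t" by force
next
  fix s assume "s \<in> (\<lambda>(a, b). sol a b) ` index_pairs t"
  then obtain a b where "gcd (gcd a b) N = int t" "s = sol a b" unfolding index_pairs_def by auto
  then show "s \<in> {sol a b | a b. rational a b \<and> gcd (gcd a b) N = int t}"
    using index_pairs_rational[OF t] by blast
qed

text \<open>By \<open>sol_eq_iff\<close>, the fibre is a class under negation modulo
  \<open>N\<close>. The two listed pairs may coincide; \<open>neg_fixed_iff\<close> tells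
  when.\<close>

lemma fibre_index_pairs:
  assumes t: "t \<in> D_set p" and ab: "(a, b) \<in> index_pairs t"
  shows "{x \<in> index_pairs t. (\<lambda>(a, b). sol a b) x = sol a b} = {(a, b), ((- a) mod N, (- b) mod N)}"
proof (intro equalityI subsetI)
  have I_iff: "(a, b) \<in> index_pairs t \<longleftrightarrow> 0 \<le> a \<and> a < N \<and> 0 \<le> b \<and> b < N \<and> gcd (gcd a b) N = int t" for a b
    unfolding index_pairs_def by simp
  note h = ab[unfolded I_iff]
  have g: "rational a b" using index_pairs_rational[OF t] h by blast
  {
    fix x assume x: "x \<in> {x \<in> index_pairs t. (\<lambda>(a, b). sol a b) x = sol a b}"
    obtain c d where cd: "x = (c, d)" by force
    have xI: "(c, d) \<in> index_pairs t" "sol c d = sol a b" using x cd by auto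
    note h' = xI(1)[unfolded I_iff]
    have "rational c d" using index_pairs_rational[OF t] h' by blast
    from sol_eq_iff[OF this g] xI(2)
    consider "N dvd c - a" "N dvd d - b" | "N dvd c - (- a)" "N dvd d - (- b)" by auto
    then have "(c mod N = a mod N \<and> d mod N = b mod N) \<or> (c mod N = (- a) mod N \<and> d mod N = (- b) mod N)"
      by cases (simp_all only: mod_eq_dvd_iff simp_thms)
    then have "(c = a \<and> d = b) \<or> (c = (- a) mod N \<and> d = (- b) mod N)"
      using h h' by (simp only: mod_pos_pos_trivial)
    then show "x \<in> {(a, b), ((- a) mod N, (- b) mod N)}" unfolding cd by auto
  next
    have gm: "gcd (gcd ((- a) mod N) ((- b) mod N)) N = int t"
      using h by (subst gcd_gcd_eqI[of N _ _ a b]) (simp_all add: dvd_mod_iff)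
    have "((- a) mod N, (- b) mod N) \<in> index_pairs t"
      unfolding I_iff using gm N_pos by simp
    moreover have "sol ((- a) mod N) ((- b) mod N) = sol a b"
    proof -
      have "N dvd (- x) mod N - (- x)" for x by (simp only: mod_eq_dvd_iff[symmetric] mod_mod_trivial)
      then show ?thesis
        by (subst sol_eq_iff[OF index_pairs_rational[OF t gm] g]) simp
    qed
    moreover fix x assume "x \<in> {(a, b), ((- a) mod N, (- b) mod N)}"
    ultimately show "x \<in> {x \<in> index_pairs t. (\<lambda>(a, b). sol a b) x = sol a b}"
      using ab by auto
  }
qed

text \<open>A pair is its own negative modulo \<open>N\<close> iff \<open>N\<close> divides
  \<open>2 * a\<close> and \<open>2 * b\<close>, that is, iff \<open>N dvd 2 * t\<close>. As
  \<open>t\<close> divides \<open>N\<close>, its cofactor is then 1 or 2.\<close>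

lemma neg_fixed_iff:
  assumes t: "t \<in> D_set p" and ab: "(a, b) \<in> index_pairs t"
  shows "(a, b) = ((- a) mod N, (- b) mod N) \<longleftrightarrow> t = p\<^sup>2 - 1 \<or> t = (p\<^sup>2 - 1) div 2"
proof -
  have h: "0 \<le> a" "a < N" "0 \<le> b" "b < N" "gcd (gcd a b) N = int t"
    using ab unfolding index_pairs_def by simp_all
  have fix1: "x = (- x) mod N \<longleftrightarrow> N dvd 2 * x" if "0 \<le> x" "x < N" for x
  proof -
    have "x = (- x) mod N \<longleftrightarrow> x mod N = (- x) mod N" using that by (simp only: mod_pos_pos_trivial)
    also have "\<dots> \<longleftrightarrow> N dvd 2 * x" by (simp add: mod_eq_dvd_iff)
    finally show ?thesis .
  qed
  have "(a, b) = ((- a) mod N, (- b) mod N) \<longleftrightarrow> N dvd 2 * a \<and> N dvd 2 * b"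
    unfolding prod.inject using fix1 h by blast
  also have "\<dots> \<longleftrightarrow> N dvd 2 * int t"
  proof
    assume "N dvd 2 * a \<and> N dvd 2 * b"
    \<comment> \<open>Including \<open>2 * N\<close> lets the factor 2 be taken out of the whole
      gcd.\<close>
    then have "N dvd gcd (gcd (2 * a) (2 * b)) (2 * N)"
      by (simp only: gcd_greatest_iff dvd_triv_right simp_thms)
    also have "gcd (gcd (2 * a) (2 * b)) (2 * N) = 2 * gcd (gcd a b) N"
      using gcd_mult_distrib_int[of 2] by simp
    finally show "N dvd 2 * int t" using h by simp
  next
    assume *: "N dvd 2 * int t"
    have "int t dvd a" "int t dvd b" using h(5) by (metis dvd_trans gcd_dvd1 gcd_dvd2)+
    then show "N dvd 2 * a \<and> N dvd 2 * b"
      using dvd_trans[OF *] mult_dvd_mono[OF dvd_refl] by blast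
  qed
  also have "\<dots> \<longleftrightarrow> p\<^sup>2 - 1 dvd 2 * t"
    using int_dvd_int_iff[of "p\<^sup>2 - 1" "2 * t"] by (simp only: int_N of_nat_mult of_nat_numeral)
  also have "\<dots> \<longleftrightarrow> t = p\<^sup>2 - 1 \<or> t = (p\<^sup>2 - 1) div 2"
  proof -
    obtain d where d: "p\<^sup>2 - 1 = t * d" using t by (auto simp: D_set_def)
    have t0: "t > 0" by (rule D_set_pos[OF t])
    have d0: "d > 0" using d int_N N_pos by (cases d) auto
    have ev: "even (p\<^sup>2 - 1)"
      using prime_p p_ge prime_odd_nat[of p] by simp
    have "p\<^sup>2 - 1 dvd 2 * t \<longleftrightarrow> d dvd 2" using t0 unfolding d by (simp add: mult.commute)
    also have "\<dots> \<longleftrightarrow> d = 1 \<or> d = 2" using d0 by (auto dest: dvd_imp_le)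
    also have "\<dots> \<longleftrightarrow> t = p\<^sup>2 - 1 \<or> 2 * t = p\<^sup>2 - 1" using t0 unfolding d by auto
    also have "2 * t = p\<^sup>2 - 1 \<longleftrightarrow> t = (p\<^sup>2 - 1) div 2" using ev by auto
    finally show ?thesis .
  qed
  finally show ?thesis .
qed

text \<open>Counting by fibres over the orbit: all fibres have the same size, which is 1 in the two
  exceptional cases and 2 otherwise.\<close>

lemma card_index_pairs_eq_orbit:
  assumes t: "t \<in> D_set p"
  shows "real (card (index_pairs t)) =
    (if t = p\<^sup>2 - 1 \<or> t = (p\<^sup>2 - 1) div 2 then 1 else 2) * real (card (cayley_orbit (sol (int t) 0)))"
proof -
  let ?F = "\<lambda>(a, b). sol a b"
  let ?c = "if t = p\<^sup>2 - 1 \<or> t = (p\<^sup>2 - 1) div 2 then 1 else 2 :: nat"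
  have "card (index_pairs t) = (\<Sum>x\<in>index_pairs t. 1)" by simp
  also have "\<dots> = (\<Sum>s\<in>?F ` index_pairs t. \<Sum>x | x \<in> index_pairs t \<and> ?F x = s. 1)"
    by (rule sum.image_gen[OF card_index_pairs(2)[OF t]])
  also have "\<dots> = (\<Sum>s\<in>?F ` index_pairs t. ?c)"
  proof (rule sum.cong[OF refl])
    fix s assume "s \<in> ?F ` index_pairs t"
    then obtain a b where ab: "(a, b) \<in> index_pairs t" "s = sol a b" by auto
    have "(\<Sum>x | x \<in> index_pairs t \<and> ?F x = s. 1) = card {x \<in> index_pairs t. ?F x = sol a b}"
      unfolding ab(2) by simp
    also have "\<dots> = card {(a, b), ((- a) mod N, (- b) mod N)}"
      unfolding fibre_index_pairs[OF t ab(1)] ..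
    also have "\<dots> = (if (a, b) = ((- a) mod N, (- b) mod N) then 1 else 2)"
      by (simp only: card_insert_if finite.intros singleton_iff card.empty) simp
    also have "\<dots> = ?c" unfolding neg_fixed_iff[OF t ab(1)] ..
    finally show "(\<Sum>x | x \<in> index_pairs t \<and> ?F x = s. 1) = ?c" .
  qed
  also have "\<dots> = ?c * card (cayley_orbit (sol (int t) 0))"
    unfolding orbit_eq_image[OF t] by simp
  finally show ?thesis by simp
qed

text \<open>The difference of the exponents of \<open>q\<close> in p^2 - 1 and in \<open>t\<close>
  is its exponent in the cofactor, so the product in \<open>size_expr\<close> runs over the primes
  dividing the cofactor.\<close>

lemma size_expr_eq:
  assumes "t \<in> D_set p"
  shows "size_expr p t = 1 / 2 * jordan_totient ((p\<^sup>2 - 1) div t)"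
proof -
  have t: "t > 0" by (rule D_set_pos[OF assms])
  obtain d where d: "p\<^sup>2 - 1 = t * d" using assms by (auto simp: D_set_def)
  have d0: "d > 0" using d int_N N_pos by (cases d) auto
  have m: "expo p q = multiplicity q t + multiplicity q d" if "prime q" for q
    unfolding expo_def d using that t d0 by (simp add: prime_elem_multiplicity_mult_distrib)
  have "{q. prime q \<and> q dvd p\<^sup>2 - 1 \<and> multiplicity q t < expo p q} = prime_factors d"
  proof (intro equalityI subsetI)
    fix q assume "q \<in> {q. prime q \<and> q dvd p\<^sup>2 - 1 \<and> multiplicity q t < expo p q}"
    then have "prime q" "multiplicity q d > 0" using m[of q] by simp_all
    then show "q \<in> prime_factors d"
      using d0 by (simp add: prime_factors_multiplicity)
  next
    fix q assume "q \<in> prime_factors d"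
    then have q: "prime q" "q dvd d" "multiplicity q d > 0"
      by (auto simp: in_prime_factors_iff prime_multiplicity_gt_zero_iff)
    then show "q \<in> {q. prime q \<and> q dvd p\<^sup>2 - 1 \<and> multiplicity q t < expo p q}"
      using m[OF q(1)] unfolding d by simp
  qed
  moreover have "(p\<^sup>2 - 1) div t = d" using d t by simp
  moreover have "(\<Prod>q\<in>prime_factors d. ((real q)\<^sup>2 - 1) * real q ^ (2 * (expo p q - multiplicity q t - 1)))
      = jordan_totient d"
    unfolding jordan_totient_def
    by (rule prod.cong[OF refl]) (simp add: m in_prime_factors_iff)
  ultimately show ?thesis unfolding size_expr_def by simp
qed

end

subsection \<open>Orbit count\<close>

text \<open>Since \<open>p\<close> does not divide p^2 - 1, this number is nonzero in the closure
  and a root of unity of that exact order exists.\<close>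

lemma cayley_parametrization_exists:
  assumes "prime p" "p \<ge> 5" "CARD('a :: {field, finite}) = p"
  shows "\<exists>g :: 'a alg_closure. cayley_parametrization p g"
proof -
  have "\<not> p dvd p\<^sup>2 - 1"
  proof
    assume "p dvd p\<^sup>2 - 1"
    moreover have "p dvd p\<^sup>2" by (simp add: power2_eq_square)
    ultimately have "p dvd p\<^sup>2 - (p\<^sup>2 - 1)" by (rule dvd_diff_nat[rotated])
    then show False using assms(2) by simp
  qed
  then have "of_nat (p\<^sup>2 - 1) \<noteq> (0 :: 'a alg_closure)"
    using CHAR_eq_CARD[where 'a = 'a] assms(1,3) by (simp add: of_nat_eq_0_iff_char_dvd)
  moreover have "p\<^sup>2 - 1 > 0" using \<open>\<not> p dvd p\<^sup>2 - 1\<close> by (cases "p\<^sup>2 - 1 = 0") auto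
  ultimately obtain g :: "'a alg_closure" where "\<And>k. g ^ k = 1 \<longleftrightarrow> p\<^sup>2 - 1 dvd k"
    using primitive_root_of_unity_exists[of "p\<^sup>2 - 1", where 'k = "'a alg_closure"] by auto
  then show ?thesis using assms by (auto simp: cayley_parametrization_def)
qed

theorem theorem1:
  fixes p :: nat
  assumes "prime p" and "p \<ge> 5" and "CARD('a::{field,finite}) = p"
  shows "Q_plus p \<inter> Q_minus p = {}
    \<and> int p + eps p = 2 * (\<Prod>q\<in>Q_plus p. int q ^ expo p q)
    \<and> int p - eps p = 2 ^ (expo p 2 - 1) * (\<Prod>q\<in>Q_minus p. int q ^ expo p q)
    \<and> (\<exists>\<Phi> :: nat \<Rightarrow> ('a \<times> 'a \<times> 'a) set.
         bij_betw \<Phi> (D_set p) cayley_orbits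
         \<and> (\<forall>t\<in>D_set p. t \<noteq> p\<^sup>2 - 1 \<and> t \<noteq> (p\<^sup>2 - 1) div 2
               \<longrightarrow> real (card (\<Phi> t)) = size_expr p t)
         \<and> (\<forall>t\<in>{p\<^sup>2 - 1, (p\<^sup>2 - 1) div 2}. real (card (\<Phi> t)) = 2 * size_expr p t))
    \<and> int (card (cayley_orbits :: ('a \<times> 'a \<times> 'a) set set)) =
        int (expo p 2) * (\<Prod>q\<in>Q_minus p. int (expo p q) + 1)
        + 2 * (\<Prod>q\<in>Q_plus p. int (expo p q) + 1) - 2"
proof -
  have odd: "odd p" using assms(1,2) prime_odd_nat[of p] by simp
  have n: "p\<^sup>2 - 1 = (p + 1) * (p - 1)" by (simp add: power2_eq_square algebra_simps)
  \<comment> \<open>The sign \<open>eps p\<close> is such that \<open>m\<close> is the one of p + 1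
    and p - 1 that is 2 modulo 4; \<open>m'\<close> is the other.\<close>
  obtain m m' :: nat where m: "int m = int p + eps p" "int m' = int p - eps p"
    and mm: "m mod 4 = 2" "{m, m'} = {p + 1, p - 1}" "m = m' + 2 \<or> m' = m + 2" "even m'"
  proof (cases "even ((p - 1) div 2)")
    case True
    then obtain k where "(p - 1) div 2 = 2 * k" by (elim evenE)
    then have k: "p = 4 * k + 1" using odd assms(2) by (auto elim!: oddE)
    then have "p + 1 = 2 + 4 * k" by simp
    then have "(p + 1) mod 4 = 2" by (simp only: mod_mult_self2) simp
    then show ?thesis
      by (intro that[of "p + 1" "p - 1"]) (use True k assms(2) in \<open>simp_all add: eps_def of_nat_diff\<close>)
  next
    case False
    then obtain k where "(p - 1) div 2 = 2 * k + 1" by (elim oddE)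
    then have k: "p = 4 * k + 3" using odd assms(2) by (auto elim!: oddE)
    then have "p - 1 = 2 + 4 * k" by simp
    then have "(p - 1) mod 4 = 2" by (simp only: mod_mult_self2) simp
    then show ?thesis
      by (intro that[of "p - 1" "p + 1"]) (use False k assms(2) in \<open>simp_all add: eps_def of_nat_diff insert_commute\<close>)
  qed
  have nm: "p\<^sup>2 - 1 = m * m'" using mm(2) unfolding n by (auto simp: doubleton_eq_iff)
  have pos: "m > 0" "m' > 0" "even m"
  proof -
    show "m > 0" "m' > 0" using mm(2) assms(2) by (auto simp: doubleton_eq_iff)
    show "even m" using mm(1) by presburger
  qed
  have cop: "\<not> (q dvd m \<and> q dvd m')" if "prime q" "odd q" for q
  proof
    assume "q dvd m \<and> q dvd m'"
    then have "q dvd 2" using mm(3) by (metis dvd_add_right_iff)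
    then show False using that by (metis dvd_refl primes_dvd_imp_eq two_is_prime_nat)
  qed
  have Qp: "Q_plus p = {q. prime q \<and> odd q \<and> q dvd m}"
    unfolding Q_plus_def m(1)[symmetric] by simp
  have Qm: "Q_minus p = {q. prime q \<and> odd q \<and> q dvd m'}"
    unfolding Q_minus_def m(2)[symmetric] by simp
  have expo: "expo p q = multiplicity q (m * m')" "expo p q = multiplicity q (m' * m)" for q
    unfolding expo_def nm by (simp_all only: mult.commute)
  have m2: "multiplicity 2 m = 1"
  proof (rule multiplicity_eqI)
    show "2 ^ 1 dvd m" using pos by simp
    show "\<not> 2 ^ Suc 1 dvd m" using mm(1) by auto
  qed
  \<comment> \<open>As 2 divides \<open>m\<close> exactly once, \<open>expo p 2 - 1\<close> is the
    exponent of 2 in \<open>m'\<close>, and \<open>expo p 2\<close> is what the prime 2 contributes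
    to the divisor count of \<open>m'\<close>.\<close>
  have e2: "expo p 2 = multiplicity 2 m' + 1"
    using pos m2 by (simp add: expo prime_elem_multiplicity_mult_distrib)
  have c1: "\<And>q. prime q \<Longrightarrow> odd q \<Longrightarrow> q dvd m \<Longrightarrow> \<not> q dvd m'"
    and c2: "\<And>q. prime q \<Longrightarrow> odd q \<Longrightarrow> q dvd m' \<Longrightarrow> \<not> q dvd m"
    using cop by auto
  have disj: "Q_plus p \<inter> Q_minus p = {}" unfolding Qp Qm using cop by auto
  have "m = 2 * (\<Prod>q\<in>Q_plus p. q ^ expo p q)"
    using even_eq_prod_prime_powers[OF pos(3) pos(1,2) c1] unfolding Qp expo(1) m2 by simp
  then have plus: "int p + eps p = 2 * (\<Prod>q\<in>Q_plus p. int q ^ expo p q)"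
    unfolding m(1)[symmetric] by (metis (no_types, lifting) of_nat_mult of_nat_numeral of_nat_power of_nat_prod prod.cong)
  have "m' = 2 ^ (expo p 2 - 1) * (\<Prod>q\<in>Q_minus p. q ^ expo p q)"
    using even_eq_prod_prime_powers[OF mm(4) pos(2,1) c2] unfolding Qm e2 unfolding expo(2) by simp
  then have minus: "int p - eps p = 2 ^ (expo p 2 - 1) * (\<Prod>q\<in>Q_minus p. int q ^ expo p q)"
    unfolding m(2)[symmetric] by (metis (no_types, lifting) of_nat_mult of_nat_numeral of_nat_power of_nat_prod prod.cong)
  obtain g :: "'a alg_closure" where "cayley_parametrization p g"
    using cayley_parametrization_exists[OF assms] by blast
  then interpret cayley_parametrization p g .
  let ?\<Phi> = "\<lambda>t. cayley_orbit (sol (int t) 0)"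
  \<comment> \<open>Fibres of size 2 account for the factor 1/2 in \<open>size_expr\<close>; fibres
    of size 1 double the orbit.\<close>
  have sizes: "real (card (?\<Phi> t)) = (if t = p\<^sup>2 - 1 \<or> t = (p\<^sup>2 - 1) div 2 then 2 else 1) * size_expr p t"
    if "t \<in> D_set p" for t
    using card_index_pairs_eq_orbit[OF that] size_expr_eq[OF that] card_index_pairs(1)[OF that] by (auto split: if_splits)
  have mem: "p\<^sup>2 - 1 \<in> D_set p" "(p\<^sup>2 - 1) div 2 \<in> D_set p"
  proof -
    show "p\<^sup>2 - 1 \<in> D_set p" unfolding D_set_def n mem_Collect_eq
      by (simp only: dvd_triv_left dvd_refl simp_thms)
    obtain h where h: "p - 1 = 2 * h" using odd by (metis dvdE odd_two_times_div_two_nat)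
    then have *: "p\<^sup>2 - 1 = 2 * ((p + 1) * h)" unfolding n by simp
    then have "(p\<^sup>2 - 1) div 2 = (p + 1) * h" by simp
    then show "(p\<^sup>2 - 1) div 2 \<in> D_set p"
      unfolding D_set_def * mem_Collect_eq by (simp only: dvd_triv_left dvd_triv_right simp_thms)
  qed
  have "card (cayley_orbits :: ('a \<times> 'a \<times> 'a) set set) = card (D_set p)"
    using bij_betw_same_card[OF bij_betw_D_set_orbits] by simp
  moreover have "card (D_set p) + 2 = card {d. d dvd m} + card {d. d dvd m'}"
    using card_D_set[OF odd assms(2)] mm(2) by (auto simp: doubleton_eq_iff)
  moreover have "card {d. d dvd m} = 2 * (\<Prod>q\<in>Q_plus p. expo p q + 1)"
    using card_divisors_even[OF pos(3) pos(1,2) c1] unfolding Qp expo(1) m2 by simp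
  moreover have "card {d. d dvd m'} = expo p 2 * (\<Prod>q\<in>Q_minus p. expo p q + 1)"
    using card_divisors_even[OF mm(4) pos(2,1) c2] unfolding Qm e2 unfolding expo(2) by simp
  ultimately have "card (cayley_orbits :: ('a \<times> 'a \<times> 'a) set set) + 2 =
      2 * (\<Prod>q\<in>Q_plus p. expo p q + 1) + expo p 2 * (\<Prod>q\<in>Q_minus p. expo p q + 1)" by simp
  then have "int (card (cayley_orbits :: ('a \<times> 'a \<times> 'a) set set) + 2) =
      int (2 * (\<Prod>q\<in>Q_plus p. expo p q + 1) + expo p 2 * (\<Prod>q\<in>Q_minus p. expo p q + 1))" by simp
  then have count: "int (card (cayley_orbits :: ('a \<times> 'a \<times> 'a) set set)) =
        int (expo p 2) * (\<Prod>q\<in>Q_minus p. int (expo p q) + 1)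
        + 2 * (\<Prod>q\<in>Q_plus p. int (expo p q) + 1) - 2"
    by (simp add: add.commute)
  have "bij_betw ?\<Phi> (D_set p) cayley_orbits
       \<and> (\<forall>t\<in>D_set p. t \<noteq> p\<^sup>2 - 1 \<and> t \<noteq> (p\<^sup>2 - 1) div 2 \<longrightarrow> real (card (?\<Phi> t)) = size_expr p t)
       \<and> (\<forall>t\<in>{p\<^sup>2 - 1, (p\<^sup>2 - 1) div 2}. real (card (?\<Phi> t)) = 2 * size_expr p t)"
    using bij_betw_D_set_orbits sizes mem by auto
  then show ?thesis using disj plus minus count by blast
qed

end
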